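(* Let $d\in\mathbb{R}\setminus\{0\}$, $\zeta,\omega,f_0\in\mathbb{R}$, $k_1\in\mathbb{N}$, and for $f_1\in\mathbb{R}$ consider the equation $$-d u''+\mathrm{i}\omega u'+(\zeta-\mathrm{i})u-|u|^2u+\mathrm{i}f_0+\mathrm{i}f_1\mathrm{e}^{\mathrm{i}k_1s}=0,\qquad u\ 2\pi\text{-periodic}.\qquad( * )$$ Let $u_0\in\mathbb{C}$ be a constant non-degenerate solution of $( * )$ for $f_1=0$, and for $f_1$ in a neighborhood of $0$ let $f_1\mapsto u(f_1)\in H^2_{\mathrm{per}}(0,2\pi)$ be the smooth curve of solutions of $( * )$ with $u(0)=u_0$, where $u(f_1)$ is the unique solution of $( * )$ near $u_0$. Then $$\frac{d}{df_1}\|u(f_1)\|_2^2\Big|_{f_1=0}=0,\qquad \frac{d^2}{df_1^2}\|u(f_1)\|_2^2\Big|_{f_1=0}=4\pi\big(\operatorname{Re}(u_0\overline{\epsilon})+|\alpha|^2+|\beta|^2\big)$$ with $$\alpha=\frac{-\mathrm{i}(dk_1^2+k_1\omega+\zeta+\mathrm{i}-2|u_0|^2)}{(\zeta+dk_1^2-2|u_0|^2)^2-(\omega k_1+\mathrm{i})^2-|u_0|^4},\qquad \beta=\frac{\mathrm{i}u_0^2}{(\zeta+dk_1^2-2|u_0|^2)^2-(\omega k_1-\mathrm{i})^2-|u_0|^4},$$ $$x=\zeta-\mathrm{i}-2|u_0|^2,\qquad y=-u_0^2,\qquad z=4u_0(|\alpha|^2+|\beta|^2)+4\overline{u_0}\,\alpha\beta,\qquad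 \epsilon=\frac{-\overline{z}\,y+z\,\overline{x}}{|x|^2-|y|^2}.$$
   Context: All functions are complex valued and function spaces are regarded as vector spaces over $\mathbb{R}$; $\|\cdot\|_2$ is the norm of $L^2(0,2\pi)$. $H^2_{\mathrm{per}}(0,2\pi)$ is the space of locally square-integrable $2\pi$-periodic functions on $\mathbb{R}$ whose weak derivatives on $\mathbb{R}$ up to order $2$ are locally square-integrable, with the norm $\big(\sum_{j=0}^2\|u^{(j)}\|_{L^2(0,2\pi)}^2\big)^{1/2}$. A constant solution $u_0$ of $( * )$ for $f_1=0$ is called non-degenerate if the $\mathbb{R}$-linear operator $L_{u_0}\varphi=-d\varphi''+\mathrm{i}\omega\varphi'+(\zeta-\mathrm{i}-2|u_0|^2)\varphi-u_0^2\overline{\varphi}$ on $H^2_{\mathrm{per}}(0,2\pi)$ is injective; in this case, locally near $(0,u_0)$ in $\mathbb{R}\times H^2_{\mathrm{per}}(0,2\pi)$ the solution set of $( * )$ is the graph of a smooth curve $f_1\mapsto u(f_1)$. *)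

theory Defs
  imports "HOL-Analysis.Analysis"
begin

text \<open>
  Elements of the function spaces are represented by functions \<open>real \<Rightarrow> complex\<close>; two of them
  represent the same element iff they agree almost everywhere.
\<close>

definition loc_square_integrable :: "(real \<Rightarrow> complex) \<Rightarrow> bool" where
  "loc_square_integrable u \<longleftrightarrow>
     u \<in> borel_measurable lebesgue \<and>
     (\<forall>K. compact K \<longrightarrow> set_integrable lebesgue K (\<lambda>s. (cmod (u s))\<^sup>2))"

definition L2_norm :: "(real \<Rightarrow> complex) \<Rightarrow> real" where
  "L2_norm u = sqrt (LINT s:{0<..<2 * pi}|lebesgue. (cmod (u s))\<^sup>2)"

definition test_function :: "(real \<Rightarrow> real) \<Rightarrow> bool" where
  "test_function \<phi> \<longleftrightarrow>
     (\<forall>n x. (deriv ^^ n) \<phi> differentiable at x) \<and> compact (closure {x. \<phi> x \<noteq> 0})"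

text \<open>Meaningful only for locally integrable \<open>u\<close> and \<open>v\<close>, since non-convergent integrals are 0.\<close>

definition has_weak_deriv :: "nat \<Rightarrow> (real \<Rightarrow> complex) \<Rightarrow> (real \<Rightarrow> complex) \<Rightarrow> bool" where
  "has_weak_deriv j u v \<longleftrightarrow>
     (\<forall>\<phi>. test_function \<phi> \<longrightarrow>
       (LINT s|lebesgue. u s * of_real ((deriv ^^ j) \<phi> s)) =
       (- 1) ^ j * (LINT s|lebesgue. v s * of_real (\<phi> s)))"

text \<open>Weak derivatives are determined up to null sets; all uses below are insensitive to the choice.\<close>

definition weak_deriv :: "nat \<Rightarrow> (real \<Rightarrow> complex) \<Rightarrow> real \<Rightarrow> complex" where
  "weak_deriv j u = (SOME v. loc_square_integrable v \<and> has_weak_deriv j u v)"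

definition H2per :: "(real \<Rightarrow> complex) set" where
  "H2per = {u. loc_square_integrable u \<and>
               (AE s in lebesgue. u (s + 2 * pi) = u s) \<and>
               (\<forall>j\<le>2. \<exists>v. loc_square_integrable v \<and> has_weak_deriv j u v)}"

definition H2_norm :: "(real \<Rightarrow> complex) \<Rightarrow> real" where
  "H2_norm u = sqrt (\<Sum>j\<le>2. (L2_norm (weak_deriv j u))\<^sup>2)"

definition lle_solution ::
  "real \<Rightarrow> real \<Rightarrow> real \<Rightarrow> real \<Rightarrow> nat \<Rightarrow> real \<Rightarrow> (real \<Rightarrow> complex) \<Rightarrow> bool" where
  "lle_solution d \<zeta> \<omega> f0 k1 f1 u \<longleftrightarrow>
     u \<in> H2per \<and>
     (AE s in lebesgue.
        - of_real d * weak_deriv 2 u s + \<i> * of_real \<omega> * weak_deriv 1 u s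
        + (of_real \<zeta> - \<i>) * u s - of_real ((cmod (u s))\<^sup>2) * u s
        + \<i> * of_real f0 + \<i> * of_real f1 * exp (\<i> * of_nat k1 * of_real s) = 0)"

definition lin_op ::
  "real \<Rightarrow> real \<Rightarrow> real \<Rightarrow> complex \<Rightarrow> (real \<Rightarrow> complex) \<Rightarrow> real \<Rightarrow> complex" where
  "lin_op d \<zeta> \<omega> u0 \<phi> s =
     - of_real d * weak_deriv 2 \<phi> s + \<i> * of_real \<omega> * weak_deriv 1 \<phi> s
     + (of_real \<zeta> - \<i> - 2 * of_real ((cmod u0)\<^sup>2)) * \<phi> s - u0\<^sup>2 * cnj (\<phi> s)"

definition non_degenerate :: "real \<Rightarrow> real \<Rightarrow> real \<Rightarrow> complex \<Rightarrow> bool" where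
  "non_degenerate d \<zeta> \<omega> u0 \<longleftrightarrow>
     (\<forall>\<phi>\<in>H2per. \<forall>\<psi>\<in>H2per.
        (AE s in lebesgue. lin_op d \<zeta> \<omega> u0 \<phi> s = lin_op d \<zeta> \<omega> u0 \<psi> s) \<longrightarrow>
        (AE s in lebesgue. \<phi> s = \<psi> s))"

definition has_H2_derivative ::
  "(real \<Rightarrow> real \<Rightarrow> complex) \<Rightarrow> (real \<Rightarrow> complex) \<Rightarrow> real \<Rightarrow> bool" where
  "has_H2_derivative U V f \<longleftrightarrow>
     ((\<lambda>h. H2_norm (\<lambda>s. (U (f + h) s - U f s) /\<^sub>R h - V s)) \<longlongrightarrow> 0) (at 0)"

text \<open>\<open>C\<^sup>\<infinity>\<close> curves in \<open>H2per\<close> over an open set \<open>I\<close>; \<open>D n\<close> is the \<open>n\<close>-th derivative.\<close>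

definition smooth_H2_curve_on :: "real set \<Rightarrow> (real \<Rightarrow> real \<Rightarrow> complex) \<Rightarrow> bool" where
  "smooth_H2_curve_on I U \<longleftrightarrow>
     (\<exists>D :: nat \<Rightarrow> real \<Rightarrow> real \<Rightarrow> complex.
        (\<forall>f\<in>I. D 0 f = U f) \<and>
        (\<forall>n. \<forall>f\<in>I. D n f \<in> H2per \<and> has_H2_derivative (D n) (D (Suc n) f) f))"

text \<open>
  The curve is smooth near 0, passes through \<open>u0\<close>, and its graph is exactly the set of solutions
  \<open>(f1, v)\<close> in a neighbourhood of \<open>(0, u0)\<close>.
\<close>

definition local_solution_curve ::
  "real \<Rightarrow> real \<Rightarrow> real \<Rightarrow> real \<Rightarrow> nat \<Rightarrow> complex \<Rightarrow> (real \<Rightarrow> real \<Rightarrow> complex) \<Rightarrow> bool" where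
  "local_solution_curve d \<zeta> \<omega> f0 k1 u0 u \<longleftrightarrow>
     (AE s in lebesgue. u 0 s = u0) \<and>
     (\<exists>\<delta>>0. \<exists>\<rho>>0.
        smooth_H2_curve_on {-\<delta><..<\<delta>} u \<and>
        (\<forall>f1\<in>{-\<delta><..<\<delta>}.
           lle_solution d \<zeta> \<omega> f0 k1 f1 (u f1) \<and> H2_norm (\<lambda>s. u f1 s - u0) < \<rho> \<and>
           (\<forall>v. lle_solution d \<zeta> \<omega> f0 k1 f1 v \<and> H2_norm (\<lambda>s. v s - u0) < \<rho> \<longrightarrow>
                (AE s in lebesgue. v s = u f1 s))))"

end

theory Submission
  imports Defs
begin

text \<open>
  Write \<open>u f\<close> as \<open>u0 + f V + f\<^sup>2 W / 2\<close> up to higher order, where \<open>V\<close> and \<open>W\<close> are the first two derivatives of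
  the curve at 0. Differentiating the equation twice in \<open>f\<close> at the constant \<open>u0\<close> gives, with \<open>L\<close> the linearised
  operator and \<open>k = k1\<close>,

  \<open>L V = - i exp (i k s)\<close> and \<open>L W = 4 u0 \<bar>V\<bar>\<^sup>2 + 2 cnj u0 V\<^sup>2\<close>.

  The operator \<open>L\<close> preserves the span of \<open>exp (i k s)\<close> and \<open>exp (- i k s)\<close>, and \<open>\<alpha>\<close>, \<open>\<beta>\<close> solve the resulting two
  by two system; by non-degeneracy \<open>V = \<alpha> exp (i k s) + \<beta> exp (- i k s)\<close>. In particular \<open>V\<close> has mean 0,
  \<open>\<bar>V\<bar>\<^sup>2\<close> has mean \<open>\<bar>\<alpha>\<bar>\<^sup>2 + \<bar>\<beta>\<bar>\<^sup>2\<close> and \<open>V\<^sup>2\<close> has mean \<open>2 \<alpha> \<beta>\<close>. Averaging the second equation over a period, the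
  mean \<open>m\<close> of \<open>W\<close> satisfies \<open>x m + y cnj m = z\<close>, hence \<open>m = \<epsilon>\<close>. Finally, the first derivative of the squared norm is
  \<open>2 Re (\<integral> V cnj u0) = 0\<close> and the second is \<open>2 Re (\<integral> W cnj u0) + 2 \<integral> \<bar>V\<bar>\<^sup>2\<close>, which is the asserted value.
  Non-degeneracy also shows that no denominator vanishes (\<open>non_degenerate_determinant\<close>, \<open>non_degenerate_mean\<close>).

  The analytic work is to justify this for weak derivatives. The cubic term must be differentiated along a curve that
  converges in the Sobolev norm. The embedding \<open>sobolev_embedding\<close> into the essentially bounded functions turns it into
  a curve in an algebra, where the product rule \<open>has_ess_derivative_mult\<close> applies. The equation is only
  differentiated after it has been paired with a test function (\<open>lle_curve_derivatives\<close>). The first variation is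
  recovered almost everywhere by the fundamental lemma of the calculus of variations (\<open>fundamental_lemma\<close>), and the
  mean of the second variation is obtained from a test function whose \<open>2 \<pi>\<close>-translates sum to 1
  (\<open>periodic_partition_of_unity\<close>).
\<close>

section \<open>Test functions\<close>

text \<open>
  Bounded orders are used because induction on the order proves all closure properties at once:
  smoothness of order \<open>n + 1\<close> is differentiability plus smoothness of order \<open>n\<close> of the derivative.
\<close>

definition smooth_upto :: "nat \<Rightarrow> (real \<Rightarrow> real) \<Rightarrow> bool" where
  "smooth_upto n f \<longleftrightarrow> (\<forall>m<n. \<forall>x. (deriv ^^ m) f differentiable at x)"

lemma smooth_upto_0 [simp]: "smooth_upto 0 f"
  by (simp add: smooth_upto_def)

lemma smooth_upto_Suc:
  "smooth_upto (Suc n) f \<longleftrightarrow> (\<forall>x. f differentiable at x) \<and> smooth_upto n (deriv f)"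
  unfolding smooth_upto_def by (simp add: All_less_Suc2 funpow_Suc_right del: funpow.simps)

lemma smooth_upto_SucI:
  assumes "\<And>x. (f has_real_derivative f' x) (at x)" "smooth_upto n f'"
  shows "smooth_upto (Suc n) f"
proof -
  have "deriv f = f'"
    using assms(1) by (auto intro: DERIV_imp_deriv)
  then show ?thesis
    using assms by (auto simp: smooth_upto_Suc real_differentiable_def)
qed

lemma smooth_upto_SucD:
  assumes "smooth_upto (Suc n) f"
  shows "(f has_real_derivative deriv f x) (at x)" "smooth_upto n (deriv f)" "smooth_upto n f"
  using assms unfolding smooth_upto_Suc
  by (simp_all add: DERIV_deriv_iff_real_differentiable)
    (use assms in \<open>simp add: smooth_upto_def\<close>)

lemma smooth_upto_add:
  "smooth_upto n f \<Longrightarrow> smooth_upto n g \<Longrightarrow> smooth_upto n (\<lambda>x. f x + g x)"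
proof (induction n arbitrary: f g)
  case (Suc n)
  show ?case
    by (rule smooth_upto_SucI[where f' = "\<lambda>x. deriv f x + deriv g x"])
      (auto intro!: DERIV_add Suc.IH smooth_upto_SucD[OF Suc.prems(1)]
         smooth_upto_SucD[OF Suc.prems(2)])
qed simp

lemma smooth_upto_const: "smooth_upto n (\<lambda>x. c)"
proof (induction n arbitrary: c)
  case (Suc n)
  show ?case
    by (rule smooth_upto_SucI[where f' = "\<lambda>x. 0"]) (auto intro!: derivative_eq_intros Suc.IH)
qed simp

lemma smooth_upto_mult:
  "smooth_upto n f \<Longrightarrow> smooth_upto n g \<Longrightarrow> smooth_upto n (\<lambda>x. f x * g x)"
proof (induction n arbitrary: f g)
  case (Suc n)
  show ?case
    by (rule smooth_upto_SucI[where f' = "\<lambda>x. deriv f x * g x + deriv g x * f x"])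
      (auto intro!: DERIV_mult smooth_upto_add Suc.IH smooth_upto_SucD[OF Suc.prems(1)] 
         smooth_upto_SucD[OF Suc.prems(2)])
qed simp

lemma smooth_upto_affine:
  "smooth_upto n f \<Longrightarrow> smooth_upto n (\<lambda>x. f (a * x + b))"
proof (induction n arbitrary: f)
  case (Suc n)
  have *: "((\<lambda>x. f (a * x + b)) has_real_derivative a * deriv f (a * x + b)) (at x)" for x
  proof -
    have "((\<lambda>x. a * x + b) has_real_derivative a) (at x)"
      by (auto intro!: derivative_eq_intros)
    from DERIV_chain'[OF this smooth_upto_SucD(1)[OF Suc.prems]] show ?thesis
      by (simp add: mult.commute)
  qed
  show ?case
    by (rule smooth_upto_SucI[OF *])
      (intro smooth_upto_mult smooth_upto_const Suc.IH smooth_upto_SucD[OF Suc.prems])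
qed simp

text \<open>
  The classical flat functions. The powers of \<open>1 / t\<close> are included so that the family is closed under
  differentiation, up to linear combinations; smoothness of all its members then follows by one induction.
\<close>

definition flat :: "nat \<Rightarrow> real \<Rightarrow> real" where
  "flat k t = (if t \<le> 0 then 0 else exp (- (1 / t)) / t ^ k)"

text \<open>
  Substituting \<open>1 / t\<close> for the argument, this is the fact that the exponential beats every power.
\<close>

lemma flat_tendsto_0: "(flat k \<longlongrightarrow> 0) (at_right 0)"
proof -
  have "((\<lambda>t. inverse t ^ k / exp (inverse t)) \<longlongrightarrow> (0::real)) (at_right 0)"
    by (rule filterlim_compose[OF tendsto_power_div_exp_0 filterlim_inverse_at_top_right])
  moreover have "\<forall>\<^sub>F t in at_right 0. inverse t ^ k / exp (inverse t) = flat k t"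
    by (rule eventually_at_right_less[THEN eventually_mono])
      (auto simp: flat_def exp_minus field_simps power_inverse)
  ultimately show ?thesis
    by (rule Lim_transform_eventually)
qed

text \<open>
  At 0 the difference quotient of \<open>flat k\<close> is \<open>flat (k + 1)\<close>, so the previous limit also gives the
  derivative there.
\<close>

lemma flat_has_derivative:
  "(flat k has_real_derivative flat (k + 2) t - real k * flat (k + 1) t) (at t)"
proof (cases "t = 0")
  case True
  have left: "(flat k has_real_derivative 0) (at_left 0)"
    unfolding has_field_derivative_iff
    by (rule tendsto_eventually) (auto simp: flat_def eventually_at_filter)
  have "\<forall>\<^sub>F t in at_right 0. flat (k + 1) t = (flat k t - flat k 0) / (t - 0)"
    by (rule eventually_at_right_less[THEN eventually_mono]) (auto simp: flat_def)
  then have right: "(flat k has_real_derivative 0) (at_right 0)"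
    unfolding has_field_derivative_iff
    by (rule Lim_transform_eventually[OF flat_tendsto_0])
  show ?thesis
    using left right True by (simp add: flat_def has_field_derivative_iff filterlim_at_split)
next
  case False
  then consider "t < 0" | "t > 0" by linarith
  then show ?thesis
  proof cases
    case 1
    have "(flat k has_real_derivative 0) (at t)"
      by (rule has_field_derivative_transform_within_open[where f = "\<lambda>_. 0" and S = "{..<0}"])
        (use 1 in \<open>auto simp: flat_def\<close>)
    then show ?thesis using 1 by (simp add: flat_def)
  next
    case 2
    have pw: "t ^ k = t * t ^ (k - Suc 0)" if "k > 0"
      using that by (metis Suc_pred power_Suc One_nat_def)
    have "((\<lambda>t. exp (- (1 / t)) / t ^ k) has_real_derivative
        flat (k + 2) t - real k * flat (k + 1) t) (at t)"
      using 2 by (auto intro!: derivative_eq_intros)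
        (cases "k = 0"; simp add: pw flat_def field_simps power2_eq_square)
    then show ?thesis
      by (rule has_field_derivative_transform_within_open[where S = "{0<..}"])
        (use 2 in \<open>auto simp: flat_def\<close>)
  qed
qed

lemma smooth_upto_flat: "smooth_upto n (flat k)"
proof (induction n arbitrary: k)
  case (Suc n)
  show ?case
    by (rule smooth_upto_SucI[OF flat_has_derivative])
      (use smooth_upto_add[OF Suc.IH smooth_upto_mult[OF smooth_upto_const Suc.IH],
         of "k + 2" "- real k" "k + 1"] in simp)
qed simp

lemma test_function_iff:
  "test_function \<phi> \<longleftrightarrow> (\<forall>n. smooth_upto n \<phi>) \<and> compact (closure {x. \<phi> x \<noteq> 0})"
  by (auto simp: test_function_def smooth_upto_def)

lemma test_functionI:
  assumes "\<And>n. smooth_upto n \<phi>" "\<And>x. x \<notin> {a..b} \<Longrightarrow> \<phi> x = 0"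
  shows "test_function \<phi>"
proof -
  have "closure {x. \<phi> x \<noteq> 0} \<subseteq> {a..b}"
    by (rule closure_minimal) (use assms(2) in fastforce)+
  then have "compact (closure {x. \<phi> x \<noteq> 0})"
    by (metis closed_closure compact_Icc compact_Int_closed inf.absorb_iff2)
  with assms(1) show ?thesis
    by (simp add: test_function_iff)
qed

lemma test_function_support:
  assumes "test_function \<phi>"
  obtains R where "R > 0" "\<And>x. x \<notin> {-R..R} \<Longrightarrow> \<phi> x = 0"
proof -
  have "bounded {x. \<phi> x \<noteq> 0}"
    using assms unfolding test_function_def by (meson bounded_subset closure_subset compact_imp_bounded)
  then obtain R where "R > 0" "\<And>x. \<phi> x \<noteq> 0 \<Longrightarrow> \<bar>x\<bar> \<le> R"
    by (auto simp: bounded_pos)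
  then show thesis
    by (intro that[of R]) (auto simp: abs_le_iff, fastforce)
qed

lemma test_function_has_deriv:
  "test_function \<phi> \<Longrightarrow> (\<phi> has_real_derivative deriv \<phi> x) (at x)"
  unfolding test_function_iff by (meson smooth_upto_SucD(1))

text \<open>
  The complement of the interval is open, so the function is locally constant there.
\<close>

lemma deriv_eq_0_outside:
  fixes f :: "real \<Rightarrow> real"
  assumes "\<And>x. x \<notin> {a..b} \<Longrightarrow> f x = 0" "x \<notin> {a..b}"
  shows "deriv f x = 0"
proof -
  have "(f has_real_derivative 0) (at x)"
    by (rule has_field_derivative_transform_within_open[where f = "\<lambda>_. 0" and S = "- {a..b}"])
      (use assms in \<open>auto simp: open_Compl\<close>)
  then show ?thesis by (rule DERIV_imp_deriv)
qed

lemma test_function_deriv: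
  assumes "test_function \<phi>"
  shows "test_function (deriv \<phi>)"
proof -
  obtain R where R: "\<And>x. x \<notin> {-R..R} \<Longrightarrow> \<phi> x = 0"
    using test_function_support[OF assms] by metis
  have "smooth_upto n (deriv \<phi>)" for n
    using assms smooth_upto_SucD(2)[of n \<phi>] by (auto simp: test_function_iff)
  then show ?thesis
    using deriv_eq_0_outside[OF R] by (intro test_functionI[where a = "-R" and b = R])
qed

lemma test_function_continuous: "test_function \<phi> \<Longrightarrow> continuous_on A \<phi>"
  by (meson DERIV_isCont continuous_at_imp_continuous_on test_function_has_deriv)

lemma test_function_measurable:
  "test_function \<phi> \<Longrightarrow> \<phi> \<in> borel_measurable borel"
  by (simp add: borel_measurable_continuous_onI test_function_continuous)

lemma test_function_bounded:
  assumes "test_function \<phi>"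
  obtains B where "B > 0" "\<And>x. \<bar>\<phi> x\<bar> \<le> B"
proof -
  obtain R where R: "R > 0" "\<And>x. x \<notin> {-R..R} \<Longrightarrow> \<phi> x = 0"
    using test_function_support[OF assms] by metis
  have "bounded (\<phi> ` {-R..R})"
    by (intro compact_imp_bounded compact_continuous_image test_function_continuous assms compact_Icc)
  then obtain B where B: "B > 0" "\<And>x. x \<in> {-R..R} \<Longrightarrow> \<bar>\<phi> x\<bar> \<le> B"
    unfolding bounded_pos by auto
  have "\<bar>\<phi> x\<bar> \<le> B" for x
    using B R(2)[of x] by (cases "x \<in> {-R..R}") auto
  with B(1) show thesis by (rule that)
qed

lemma test_function_cmult: 
  assumes "test_function \<phi>"
  shows "test_function (\<lambda>x. c * \<phi> x)"
proof -
  obtain R where "\<And>x. x \<notin> {-R..R} \<Longrightarrow> \<phi> x = 0"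
    using test_function_support[OF assms] by metis
  then show ?thesis
    using assms by (intro test_functionI[where a = "-R" and b = R] smooth_upto_mult smooth_upto_const)
      (auto simp: test_function_iff)
qed

lemma test_function_diff: 
  assumes "test_function \<phi>" "test_function \<psi>"
  shows "test_function (\<lambda>x. \<phi> x - \<psi> x)"
proof -
  obtain R S where R: "\<And>x. x \<notin> {-R..R} \<Longrightarrow> \<phi> x = 0" and S: "\<And>x. x \<notin> {-S..S} \<Longrightarrow> \<psi> x = 0"
    using test_function_support assms by metis
  have "smooth_upto n (\<lambda>x. \<phi> x + (- 1) * \<psi> x)" for n
    using assms by (intro smooth_upto_add smooth_upto_mult smooth_upto_const) (auto simp: test_function_iff)
  moreover have "\<phi> x - \<psi> x = 0" if "x \<notin> {- max R S..max R S}" for x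
    using R[of x] S[of x] that by fastforce
  ultimately show ?thesis
    by (intro test_functionI[where a = "- max R S" and b = "max R S"]) auto
qed

lemma test_function_antideriv:
  assumes "test_function f" "\<And>x. (F has_real_derivative f x) (at x)" "\<And>x. x \<notin> {a..b} \<Longrightarrow> F x = 0"
  shows "test_function F"
proof (rule test_functionI[OF _ assms(3)])
  show "smooth_upto n F" for n
    using smooth_upto_SucI[OF assms(2), of n] assms(1)  smooth_upto_SucD(3)
    by (auto simp: test_function_iff)
qed

text \<open>
  As \<open>n\<close> grows, these bumps increase to the indicator of the interval, because
  \<open>exp (- 1 / (n t))\<close> tends to 1 for every positive \<open>t\<close>. They serve both as approximations of indicators and
  as the seed of the partition of unity.
\<close>

definition bump :: "nat \<Rightarrow> real \<Rightarrow> real \<Rightarrow> real \<Rightarrow> real" where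
  "bump n a b x = flat 0 (real n * (x - a)) * flat 0 (real n * (b - x))"

lemma bump_outside: "x \<notin> {a<..<b} \<Longrightarrow> bump n a b x = 0"
  by (auto simp: bump_def flat_def mult_le_0_iff)

lemma bump_nonneg: "0 \<le> bump n a b x"
  by (auto simp: bump_def flat_def)

lemma bump_le_1: "bump n a b x \<le> 1"
proof -
  have "0 \<le> flat 0 t" "flat 0 t \<le> 1" for t
    by (auto simp: flat_def)
  then show ?thesis
    unfolding bump_def by (intro mult_le_one)
qed

lemma test_function_bump: "test_function (bump n a b)"
proof (rule test_functionI[where a = a and b = b])
  have "bump n a b = (\<lambda>x. flat 0 (real n * x + - (real n * a)) * flat 0 (- real n * x + real n * b))"
    by (auto simp: bump_def algebra_simps)
  then show "smooth_upto m (bump n a b)" for m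
    by (simp only: smooth_upto_mult smooth_upto_affine smooth_upto_flat)
qed (auto intro: bump_outside)

lemma bump_tendsto: "(\<lambda>n. bump n a b x) \<longlonglongrightarrow> indicator {a<..<b} x"
proof (cases "x \<in> {a<..<b}")
  case True
  have flat1: "(\<lambda>n. flat 0 (real n * c)) \<longlonglongrightarrow> 1" if "c > 0" for c
  proof -
    have "(\<lambda>n. exp (- (inverse (real n) * inverse c))) \<longlonglongrightarrow> exp (- (0 * inverse c))"
      by (intro tendsto_intros lim_inverse_n)
    moreover have "\<forall>\<^sub>F n in sequentially. exp (- (inverse (real n) * inverse c)) = flat 0 (real n * c)"
      using eventually_gt_at_top[of 0]
      by eventually_elim (use that in \<open>auto simp: flat_def mult_le_0_iff field_simps\<close>)
    ultimately show ?thesis by (simp add: Lim_transform_eventually)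
  qed
  show ?thesis
    unfolding bump_def using True tendsto_mult[OF flat1[of "x - a"] flat1[of "b - x"]] by simp
qed (simp add: bump_outside)

section \<open>Local integrability\<close>

lemma integrable_indicator_Icc: "integrable lebesgue (indicat_real {a..b::real})"
  by (rule integrable_real_indicator) (auto simp: emeasure_lborel_Icc_eq)

text \<open>
  The nonlinear terms and the weak derivatives are only paired with test functions, and local integrability
  is all that such pairings require.
\<close>

definition loc_integrable :: "(real \<Rightarrow> complex) \<Rightarrow> bool" where
  "loc_integrable w \<longleftrightarrow> w \<in> borel_measurable lebesgue \<and> (\<forall>a b. set_integrable lebesgue {a..b} w)"

lemma borel_measurable_lebesgueI: "f \<in> borel_measurable borel \<Longrightarrow> f \<in> borel_measurable lebesgue"
  by (simp add: measurable_completion)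

lemma integrable_mult_bounded:
  fixes w g :: "real \<Rightarrow> complex"
  assumes w: "loc_integrable w" and g: "g \<in> borel_measurable lebesgue"
    and B: "\<And>x. cmod (g x) \<le> B" and R: "\<And>x. x \<notin> {-R..R} \<Longrightarrow> g x = 0"
  shows "integrable lebesgue (\<lambda>x. w x * g x)"
proof (rule Bochner_Integration.integrable_bound)
  show "integrable lebesgue (\<lambda>x. B *\<^sub>R (indicator {-R..R} x *\<^sub>R w x))"
    using w unfolding loc_integrable_def set_integrable_def by (intro integrable_scaleR_right) auto
  show "(\<lambda>x. w x * g x) \<in> borel_measurable lebesgue"
    using w g unfolding loc_integrable_def by auto
  have "B \<ge> 0" using B[of 0] norm_ge_zero order_trans by blast
  then have "cmod (w x * g x) \<le> norm (B *\<^sub>R (indicator {-R..R} x *\<^sub>R w x))" for x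
    using B[of x] R[of x] by (cases "x \<in> {-R..R}") (auto simp: norm_mult mult.commute mult_right_mono)
  then show "AE x in lebesgue. cmod (w x * g x) \<le> norm (B *\<^sub>R (indicator {-R..R} x *\<^sub>R w x))"
    by simp
qed

lemma integrable_mult_test:
  assumes w: "loc_integrable w" and \<phi>: "test_function \<phi>"
  shows "integrable lebesgue (\<lambda>x. w x * of_real (\<phi> x))"
proof -
  obtain R where R: "\<And>x. x \<notin> {-R..R} \<Longrightarrow> \<phi> x = 0"
    using test_function_support[OF \<phi>] by metis
  obtain B where B: "\<And>x. \<bar>\<phi> x\<bar> \<le> B"
    using test_function_bounded[OF \<phi>] by metis
  have [measurable]: "\<phi> \<in> borel_measurable lebesgue"
    by (intro borel_measurable_lebesgueI test_function_measurable \<phi>)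
  show ?thesis
    by (rule integrable_mult_bounded[OF w, where B = B and R = R]) (use B R in auto)
qed

lemma loc_integrable_Icc: "loc_integrable w \<Longrightarrow> set_integrable lebesgue {a..b} w"
  by (simp add: loc_integrable_def)

lemma loc_integrable_measurable: "loc_integrable w \<Longrightarrow> w \<in> borel_measurable lebesgue"
  by (simp add: loc_integrable_def)

lemma loc_integrable_add:
  "loc_integrable v \<Longrightarrow> loc_integrable w \<Longrightarrow> loc_integrable (\<lambda>x. v x + w x)"
  unfolding loc_integrable_def by (auto intro: set_integral_add)

lemma loc_integrable_cmult:
  "loc_integrable w \<Longrightarrow> loc_integrable (\<lambda>x. c * w x)"
  unfolding loc_integrable_def by (auto intro: set_integrable_mult_right)

lemma loc_integrable_cnj:
  assumes "loc_integrable w" shows "loc_integrable (\<lambda>x. cnj (w x))"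
proof -
  have [measurable]: "w \<in> borel_measurable lebesgue"
    using assms by (rule loc_integrable_measurable)
  have "(\<lambda>x. cnj (w x)) \<in> borel_measurable lebesgue"
    by (rule borel_measurable_continuous_on[where f = cnj]) (auto intro: continuous_intros)
  moreover have "integrable lebesgue (\<lambda>x. cnj (indicator {a..b} x *\<^sub>R w x))" for a b
    using assms unfolding loc_integrable_def set_integrable_def by (intro integrable_cnj) auto
  ultimately show ?thesis
    unfolding loc_integrable_def set_integrable_def by (simp add: complex_cnj_scaleR)
qed

text \<open>
  Compact sets have finite measure, so \<open>t \<le> 1 + t\<^sup>2\<close> suffices.
\<close>

lemma loc_square_integrable_imp_loc_integrable:
  assumes "loc_square_integrable w"
  shows "loc_integrable w"
  unfolding loc_integrable_def
proof (intro conjI allI)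
  show [measurable]: "w \<in> borel_measurable lebesgue"
    using assms by (simp add: loc_square_integrable_def)
  fix a b :: real
  have sq: "set_integrable lebesgue {a..b} (\<lambda>s. (cmod (w s))\<^sup>2)"
    using assms by (simp add: loc_square_integrable_def)
  have "set_integrable lebesgue {a..b} (\<lambda>s. 1 + (cmod (w s))\<^sup>2)"
    by (intro set_integral_add sq) (simp add: set_integrable_def integrable_indicator_Icc)
  then show "set_integrable lebesgue {a..b} w"
    unfolding set_integrable_def
  proof (rule Bochner_Integration.integrable_bound)
    have "t \<le> 1 + t\<^sup>2" for t :: real
      using zero_le_power2[of "t - 1 / 2"] by (simp add: power2_eq_square algebra_simps)
    then show "AE x in lebesgue. norm (indicat_real {a..b} x *\<^sub>R w x)
         \<le> norm (indicat_real {a..b} x *\<^sub>R (1 + (cmod (w x))\<^sup>2))"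
      by (intro AE_I2) (auto simp: indicator_def abs_of_nonneg)
    show "(\<lambda>x. indicat_real {a..b} x *\<^sub>R w x) \<in> borel_measurable lebesgue"
      by (intro borel_measurable_scaleR borel_measurable_indicator) auto
  qed
qed

lemma loc_square_integrable_lincomb:
  assumes "loc_square_integrable v" "loc_square_integrable w"
  shows "loc_square_integrable (\<lambda>x. a * v x + b * w x)"
  unfolding loc_square_integrable_def
proof (intro conjI allI impI)
  have [measurable]: "v \<in> borel_measurable lebesgue" "w \<in> borel_measurable lebesgue"
    using assms by (auto simp: loc_square_integrable_def)
  show "(\<lambda>x. a * v x + b * w x) \<in> borel_measurable lebesgue"
    by measurable
  fix K :: "real set" assume K: "compact K"
  have [measurable]: "K \<in> sets lebesgue"
    using K by (simp add: borel_compact)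
  have "set_integrable lebesgue K
      (\<lambda>s. 2 * (cmod a)\<^sup>2 * (cmod (v s))\<^sup>2 + 2 * (cmod b)\<^sup>2 * (cmod (w s))\<^sup>2)"
    using K assms unfolding loc_square_integrable_def
    by (intro set_integral_add set_integrable_mult_right) auto
  then show "set_integrable lebesgue K (\<lambda>s. (cmod (a * v s + b * w s))\<^sup>2)"
    unfolding set_integrable_def
  proof (rule Bochner_Integration.integrable_bound)
    have "(cmod (p + q))\<^sup>2 \<le> 2 * (cmod p)\<^sup>2 + 2 * (cmod q)\<^sup>2" for p q
    proof -
      have "(cmod (p + q))\<^sup>2 \<le> (cmod p + cmod q)\<^sup>2"
        by (simp add: norm_triangle_ineq power_mono)
      also have "\<dots> \<le> 2 * (cmod p)\<^sup>2 + 2 * (cmod q)\<^sup>2"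
        using sum_squares_bound[of "cmod p" "cmod q"] by (simp add: power2_sum)
      finally show ?thesis .
    qed
    from this[of "a * v s" "b * w s" for s]
    have "(cmod (a * v s + b * w s))\<^sup>2 \<le> 2 * (cmod a)\<^sup>2 * (cmod (v s))\<^sup>2 + 2 * (cmod b)\<^sup>2 * (cmod (w s))\<^sup>2"
      for s by (simp add: norm_mult power_mult_distrib mult.assoc)
    then show "AE x in lebesgue. norm (indicat_real K x *\<^sub>R (cmod (a * v x + b * w x))\<^sup>2)
         \<le> norm (indicat_real K x *\<^sub>R (2 * (cmod a)\<^sup>2 * (cmod (v x))\<^sup>2 + 2 * (cmod b)\<^sup>2 * (cmod (w x))\<^sup>2))"
      by (intro AE_I2) (auto simp: indicator_def)
  qed measurable
qed

section \<open>Essential bounds from test functions\<close>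

text \<open>
  An essential bound can be read off from pairings with nonnegative test functions. Letting the bumps
  increase to indicators bounds the average of \<open>w\<close> over every subinterval by \<open>M\<close>, and almost every point is a
  Lebesgue point, where \<open>w\<close> is the limit of such averages. With \<open>M = 0\<close> this is the fundamental lemma of the
  calculus of variations; with a suitable \<open>M\<close> it is the Sobolev embedding.
\<close>

lemma AE_bound_of_test_bound:
  fixes w :: "real \<Rightarrow> complex"
  assumes w: "loc_integrable w" and "M \<ge> 0"
    and bound: "\<And>\<phi>. test_function \<phi> \<Longrightarrow> (\<And>x. \<phi> x \<ge> 0) \<Longrightarrow>
      (\<exists>a b. p < a \<and> b < q \<and> (\<forall>x. x \<notin> {a..b} \<longrightarrow> \<phi> x = 0)) \<Longrightarrow>
      cmod (LINT s|lebesgue. w s * of_real (\<phi> s)) \<le> M * (LINT s|lebesgue. \<phi> s)"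
  shows "AE s in lebesgue. s \<in> {p<..<q} \<longrightarrow> cmod (w s) \<le> M"
proof -
  have wm [measurable]: "w \<in> borel_measurable lebesgue"
    by (rule loc_integrable_measurable[OF w])
  have interval: "cmod (integral {a..b} w) \<le> M * (b - a)" if ab: "p < a" "a < b" "b < q" for a b
  proof -
    have ind: "integrable lebesgue (\<lambda>s. indicator {a..b} s *\<^sub>R w s)"
      using loc_integrable_Icc[OF w] by (simp add: set_integrable_def)
    have ind': "integrable lebesgue (indicat_real {a..b})"
      by (rule integrable_indicator_Icc)
    have [measurable]: "bump n a b \<in> borel_measurable lebesgue" for n
      by (intro borel_measurable_lebesgueI test_function_measurable test_function_bump)
    have b1: "\<bar>bump n a b s\<bar> \<le> indicator {a..b} s" for n s
      using bump_outside[of s a b n] bump_nonneg[of n a b s] bump_le_1[of n a b s]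
      by (auto simp: indicator_def)
    have "(\<lambda>n. LINT s|lebesgue. w s * of_real (bump n a b s)) \<longlonglongrightarrow>
        (LINT s|lebesgue. w s * of_real (indicator {a<..<b} s))"
    proof (rule integral_dominated_convergence)
      show "integrable lebesgue (\<lambda>s. cmod (indicator {a..b} s *\<^sub>R w s))"
        using ind by (rule integrable_norm)
      show "AE s in lebesgue. (\<lambda>n. w s * of_real (bump n a b s)) \<longlonglongrightarrow> w s * of_real (indicator {a<..<b} s)"
        by (intro AE_I2 tendsto_intros bump_tendsto)
      show "AE s in lebesgue. cmod (w s * of_real (bump n a b s)) \<le> cmod (indicator {a..b} s *\<^sub>R w s)" for n
        using b1[of n] by (intro AE_I2) (auto simp: norm_mult mult.commute mult_left_mono)
      show "(\<lambda>s. w s * of_real (indicator {a<..<b} s)) \<in> borel_measurable lebesgue"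
        unfolding mult.commute[of "w _"] scaleR_conv_of_real[symmetric]
        by (intro borel_measurable_scaleR borel_measurable_indicator wm) auto
    qed measurable
    moreover have "(LINT s|lebesgue. w s * of_real (indicator {a<..<b} s)) = integral {a..b} w"
    proof -
      have "set_integrable lebesgue {a<..<b} w"
        by (rule set_integrable_subset[OF loc_integrable_Icc[OF w, of a b]]) auto
      then have "integral {a<..<b} w = (LINT s:{a<..<b}|lebesgue. w s)"
        by (simp add: set_lebesgue_integral_eq_integral)
      also have "\<dots> = (LINT s|lebesgue. w s * of_real (indicator {a<..<b} s))"
        unfolding set_lebesgue_integral_def by (simp add: scaleR_conv_of_real mult.commute)
      finally show ?thesis by (simp add: integral_open_interval_real)
    qed
    ultimately have lim: "(\<lambda>n. cmod (LINT s|lebesgue. w s * of_real (bump n a b s))) \<longlonglongrightarrow>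
        cmod (integral {a..b} w)"
      by (simp add: tendsto_norm)
    have le: "cmod (LINT s|lebesgue. w s * of_real (bump n a b s)) \<le> M * (b - a)" for n
    proof -
      have "cmod (LINT s|lebesgue. w s * of_real (bump n a b s)) \<le> M * (LINT s|lebesgue. bump n a b s)"
      proof (rule bound[OF test_function_bump bump_nonneg])
        have "\<forall>x. x \<notin> {a..b} \<longrightarrow> bump n a b x = 0"
          by (auto intro!: bump_outside)
        then show "\<exists>a' b'. p < a' \<and> b' < q \<and> (\<forall>x. x \<notin> {a'..b'} \<longrightarrow> bump n a b x = 0)"
          using ab by blast
      qed
      also have "(LINT s|lebesgue. bump n a b s) \<le> (LINT s|lebesgue. indicator {a..b} s)"
      proof (rule integral_mono[OF _ ind'])
        show "integrable lebesgue (bump n a b)"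
          by (rule Bochner_Integration.integrable_bound[OF ind']) (use b1[of n] in auto)
      qed (use b1[of n] in \<open>auto simp: abs_le_iff\<close>)
      finally show ?thesis using ab \<open>M \<ge> 0\<close> by (simp add: mult_left_mono)
    qed
    show ?thesis
      by (rule LIMSEQ_le_const2[OF lim]) (use le in auto)
  qed
  have "w integrable_on cbox a b" for a b
    using loc_integrable_Icc[OF w, of a b] set_lebesgue_integral_eq_integral(1) by auto
  then obtain N where N: "negligible N" and
    lim: "\<And>x e. \<lbrakk>x \<notin> N; 0 < e\<rbrakk> \<Longrightarrow> \<exists>d>0. \<forall>h. 0 < h \<and> h < d \<longrightarrow>
        norm (integral (cbox x (x + h *\<^sub>R One)) w /\<^sub>R h ^ DIM(real) - w x) < e"
    using integrable_ccontinuous_explicit[of w] by metis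
  have "cmod (w x) \<le> M" if x: "x \<notin> N" "x \<in> {p<..<q}" for x
  proof (rule field_le_epsilon)
    fix e :: real assume "e > 0"
    with lim[OF x(1)] obtain d where d: "d > 0" "\<And>h. 0 < h \<Longrightarrow> h < d \<Longrightarrow>
        cmod (integral {x..x + h} w /\<^sub>R h - w x) < e" by force
    \<comment> \<open>The step must stay below \<open>d\<close> and keep the averaging interval inside \<open>{p<..<q}\<close>.\<close>
    define h where "h = min d (q - x) / 2"
    have h: "0 < h" "h < d" "x + h < q"
      using d(1) x(2) by (auto simp: h_def min_def field_simps)
    have "cmod (integral {x..x + h} w /\<^sub>R h) \<le> M"
      using interval[of x "x + h"] h x(2) by (simp add: norm_divide field_simps)
    moreover have "cmod (w x) \<le> cmod (integral {x..x + h} w /\<^sub>R h) + cmod (integral {x..x + h} w /\<^sub>R h - w x)"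
      by (metis norm_minus_commute norm_triangle_sub)
    ultimately show "cmod (w x) \<le> M + e"
      using d(2)[OF h(1,2)] by linarith
  qed
  then show ?thesis
    using N unfolding negligible_iff_null_sets
    by (intro AE_I'[of N]) auto
qed

lemma fundamental_lemma:
  assumes w: "loc_integrable w"
    and zero: "\<And>\<phi>. test_function \<phi> \<Longrightarrow> (LINT s|lebesgue. w s * of_real (\<phi> s)) = 0"
  shows "AE s in lebesgue. w s = 0"
proof -
  have "AE s in lebesgue. s \<in> {- real n<..<real n} \<longrightarrow> cmod (w s) \<le> 0" for n
    by (rule AE_bound_of_test_bound[OF w]) (auto simp: zero)
  then have "AE s in lebesgue. \<forall>n. s \<in> {- real n<..<real n} \<longrightarrow> cmod (w s) \<le> 0"
    by (subst AE_all_countable) blast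
  then show ?thesis
  proof eventually_elim
    case (elim s)
    obtain n where "\<bar>s\<bar> < real n" using reals_Archimedean2 by blast
    then show ?case using elim by (auto simp: abs_less_iff)
  qed
qed

section \<open>The Sobolev embedding\<close>

text \<open>
  The primitive vanishes to the left of the support and is constant to the right of it, so it is again a
  test function if the integral vanishes. The uniform bound by the \<open>L\<^sup>1\<close> norm drives the Sobolev embedding.
\<close>

lemma primitive_of_test_function:
  assumes f: "test_function f" and supp: "\<And>x. x \<notin> {a<..<b} \<Longrightarrow> f x = 0" and "a \<le> b"
  obtains F where "\<And>x. (F has_real_derivative f x) (at x)" "\<And>x. x \<le> a \<Longrightarrow> F x = 0"
    "\<And>x. b \<le> x \<Longrightarrow> F x = (LINT s|lebesgue. f s)" "\<And>x. \<bar>F x\<bar> \<le> (LINT s|lebesgue. \<bar>f s\<bar>)"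
proof -
  have cont: "isCont f x" for x
    using DERIV_isCont test_function_has_deriv[OF f] by blast
  obtain G where G: "\<And>x. (G has_real_derivative f x) (at x)"
    using einterval_antiderivative[of "-\<infinity>" \<infinity> f] cont
    by (auto simp: has_real_derivative_iff_has_vector_derivative)
  define F where "F x = G x - G a" for x
  have F: "(F has_real_derivative f x) (at x)" for x
    unfolding F_def using G[of x] by (auto intro!: derivative_eq_intros)
  have meas: "f \<in> borel_measurable borel"
    by (rule test_function_measurable[OF f])
  have int: "integrable lebesgue f"
  proof -
    have "set_integrable lborel {a..b} f"
      by (rule borel_integrable_atLeastAtMost') (rule test_function_continuous[OF f])
    moreover have "(\<lambda>s. indicator {a..b} s *\<^sub>R f s) = f"
    proof
      fix s show "indicator {a..b} s *\<^sub>R f s = f s"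
        using supp[of s] by (cases "s \<in> {a..b}") auto
    qed
    ultimately have "integrable lborel f"
      by (simp only: set_integrable_def)
    then show ?thesis
      using meas by (simp add: integrable_completion)
  qed
  have FTC: "F x - F y = (LINT s|lebesgue. indicator {y..x} s * f s)" if "y \<le> x" for x y
  proof -
    have "(LINT s|lborel. f s * indicator {y..x} s) = F x - F y"
      by (rule integral_FTC_Icc_real) (use F cont that in auto)
    then show ?thesis
      using meas by (subst integral_completion) (auto simp: mult.commute)
  qed
  show thesis
  proof
    show F0: "F x = 0" if "x \<le> a" for x
    proof -
      have "(\<lambda>s. indicator {x..a} s * f s) = (\<lambda>s. 0)"
        using supp by (auto simp: indicator_def fun_eq_iff)
      then have "F a - F x = 0"
        unfolding FTC[OF that] by (simp only: integral_zero)
      then show ?thesis by (simp add: F_def)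
    qed
    show "F x = (LINT s|lebesgue. f s)" if "b \<le> x" for x
    proof -
      have "(\<lambda>s. indicator {a..x} s * f s) = f"
      proof
        fix s show "indicator {a..x} s * f s = f s"
          using supp[of s] that by (cases "s \<in> {a<..<b}") auto
      qed
      then have "F x - F a = (LINT s|lebesgue. f s)"
        using FTC[of a x] that \<open>a \<le> b\<close> by (simp only: order_trans)
      then show ?thesis by (simp add: F_def)
    qed
    show "\<bar>F x\<bar> \<le> (LINT s|lebesgue. \<bar>f s\<bar>)" for x
    proof (cases "a \<le> x")
      case True
      have "F x = (LINT s|lebesgue. indicator {a..x} s * f s)"
        using FTC[OF True] by (simp add: F_def)
      also have "\<bar>\<dots>\<bar> \<le> (LINT s|lebesgue. \<bar>indicator {a..x} s * f s\<bar>)"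
        by (rule integral_abs_bound)
      also have "\<dots> \<le> (LINT s|lebesgue. \<bar>f s\<bar>)"
      proof (rule integral_mono)
        show "integrable lebesgue (\<lambda>s. \<bar>indicator {a..x} s * f s\<bar>)"
          using integrable_mult_indicator[OF _ int, of "{a..x}"] by auto
      qed (use int in \<open>auto simp: indicator_def\<close>)
      finally show ?thesis .
    qed (simp add: F0)
  qed (rule F)
qed

lemma standard_bump:
  obtains \<eta> where "test_function \<eta>" "\<And>x. \<eta> x \<ge> 0" "\<And>x. x \<notin> {0<..<2*pi} \<Longrightarrow> \<eta> x = 0"
    "(LINT s|lebesgue. \<eta> s) = 1"
proof -
  define \<theta> where "\<theta> = bump 1 0 (2 * pi)"
  have \<theta>: "test_function \<theta>" "\<And>x. x \<notin> {0<..<2*pi} \<Longrightarrow> \<theta> x = 0" "\<And>x. \<theta> x \<ge> 0"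
    by (auto simp: \<theta>_def test_function_bump bump_outside bump_nonneg)
  obtain F where F: "\<And>x. (F has_real_derivative \<theta> x) (at x)" "F 0 = 0" 
    "F (2*pi) = (LINT s|lebesgue. \<theta> s)"
    using primitive_of_test_function[OF \<theta>(1,2)] by (metis order_refl pi_ge_zero zero_le_mult_iff zero_le_numeral)
  have "F 0 < F (2 * pi)"
  proof (rule DERIV_pos_imp_increasing_open[where f = F])
    show "\<exists>y. (F has_real_derivative y) (at x) \<and> 0 < y" if "0 < x" "x < 2 * pi" for x
      using F(1)[of x] that by (auto simp: \<theta>_def bump_def flat_def mult_less_0_iff intro!: exI)
    show "continuous_on {0..2 * pi} F"
      using F(1) by (meson DERIV_isCont continuous_at_imp_continuous_on)
  qed auto
  then have pos: "(LINT s|lebesgue. \<theta> s) > 0"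
    using F by simp
  show thesis
  proof
    show "test_function (\<lambda>x. (1 / (LINT s|lebesgue. \<theta> s)) * \<theta> x)"
      by (rule test_function_cmult[OF \<theta>(1)])
    show "(LINT x|lebesgue. (1 / (LINT s|lebesgue. \<theta> s)) * \<theta> x) = 1"
      using pos by (subst integral_mult_right_zero) simp
  qed (use \<theta> pos in auto)
qed

text \<open>
  The one-dimensional Sobolev inequality, by duality. Given a test
  function \<open>\<phi>\<close> with integral \<open>c\<close>, the function \<open>\<phi> - c \<eta>\<close> has integral 0 and hence a primitive \<open>F\<close> that is a test
  function with \<open>\<bar>F\<bar> \<le> 2 c\<close>. Therefore \<open>\<integral> w \<phi> = c \<integral> w \<eta> - \<integral> v F\<close>, which is at most a constant times \<open>c\<close>.
\<close>

lemma has_weak_deriv_bound: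
  assumes w: "loc_integrable w" and v: "loc_integrable v" and weak: "has_weak_deriv 1 w v"
    and \<eta>: "test_function \<eta>" "\<And>x. \<eta> x \<ge> 0" "\<And>x. x \<notin> {0<..<2*pi} \<Longrightarrow> \<eta> x = 0"
    "(LINT s|lebesgue. \<eta> s) = 1"
  shows "AE s in lebesgue. s \<in> {0<..<2*pi} \<longrightarrow>
    cmod (w s) \<le> cmod (LINT s|lebesgue. w s * of_real (\<eta> s)) + 2 * (LINT s:{0<..<2*pi}|lebesgue. cmod (v s))"
proof (rule AE_bound_of_test_bound[OF w])
  let ?V = "LINT s:{0<..<2*pi}|lebesgue. cmod (v s)"
  let ?W = "LINT s|lebesgue. w s * of_real (\<eta> s)"
  have vint: "integrable lebesgue (\<lambda>s. indicat_real {0<..<2*pi} s *\<^sub>R cmod (v s))"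
  proof -
    have "set_integrable lebesgue {0<..<2*pi} v"
      by (rule set_integrable_subset[OF loc_integrable_Icc[OF v, of 0 "2 * pi"]]) auto
    from set_integrable_norm[OF this] show ?thesis by (simp add: set_integrable_def)
  qed
  have V0: "?V \<ge> 0"
    unfolding set_lebesgue_integral_def by (rule integral_nonneg_AE) simp
  then show "cmod ?W + 2 * ?V \<ge> 0" by simp
  have real_int: "integrable lebesgue f" if "test_function f" for f
    using that integrable_mult_test[of "\<lambda>_. 1", OF _ that]
    by (simp add: loc_integrable_def set_integrable_def integrable_indicator_Icc complex_of_real_integrable_eq)
  fix \<phi> assume \<phi>: "test_function \<phi>" and \<phi>0: "\<And>x. \<phi> x \<ge> 0"
    and "\<exists>a b. 0 < a \<and> b < 2 * pi \<and> (\<forall>x. x \<notin> {a..b} \<longrightarrow> \<phi> x = 0)"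
  then have \<phi>supp: "\<phi> x = 0" if "x \<notin> {0<..<2*pi}" for x
    using that by (metis atLeastAtMost_iff greaterThanLessThan_iff order_le_less_trans order_less_le_trans)
  define c where "c = (LINT s|lebesgue. \<phi> s)"
  have "c \<ge> 0" unfolding c_def by (rule integral_nonneg_AE) (simp add: \<phi>0)
  \<comment> \<open>Subtracting \<open>c \<eta>\<close> makes the integral vanish, so the primitive below has compact support.\<close>
  define f where "f x = \<phi> x - c * \<eta> x" for x
  have f: "test_function f"
    unfolding f_def by (intro test_function_diff test_function_cmult \<phi> \<eta>)
  have fsupp: "f x = 0" if "x \<notin> {0<..<2*pi}" for x
    using that by (simp add: f_def \<phi>supp \<eta>(3))
  have fint: "(LINT s|lebesgue. f s) = 0"
    using real_int[OF \<phi>] real_int[OF \<eta>(1)] by (simp add: f_def c_def \<eta>(4))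
  have fabs: "(LINT s|lebesgue. \<bar>f s\<bar>) \<le> 2 * c"
  proof -
    have "(LINT s|lebesgue. \<bar>f s\<bar>) \<le> (LINT s|lebesgue. \<phi> s + c * \<eta> s)"
      using real_int[OF \<phi>] real_int[OF \<eta>(1)] real_int[OF f] \<open>c \<ge> 0\<close> \<phi>0 \<eta>(2)
      by (intro integral_mono) (auto simp: f_def abs_le_iff)
    also have "\<dots> = 2 * c"
      using real_int[OF \<phi>] real_int[OF \<eta>(1)] by (simp add: c_def \<eta>(4))
    finally show ?thesis .
  qed
  obtain F where F: "\<And>x. (F has_real_derivative f x) (at x)" "\<And>x. x \<le> 0 \<Longrightarrow> F x = 0"
    "\<And>x. 2 * pi \<le> x \<Longrightarrow> F x = 0" "\<And>x. \<bar>F x\<bar> \<le> (LINT s|lebesgue. \<bar>f s\<bar>)"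
    using primitive_of_test_function[OF f fsupp, of 0 "2*pi"] fint by auto
  have Fsupp: "F x = 0" if "x \<notin> {0<..<2*pi}" for x
    using that F(2,3)[of x] by force
  have Ftest: "test_function F"
    by (rule test_function_antideriv[OF f F(1), of 0 "2*pi"]) (use Fsupp in auto)
  have "deriv F = f"
    using F(1) by (auto intro: DERIV_imp_deriv)
  then have "(LINT s|lebesgue. w s * of_real (f s)) = - (LINT s|lebesgue. v s * of_real (F s))"
    using weak[unfolded has_weak_deriv_def, rule_format, OF Ftest] by simp
  moreover have "cmod (LINT s|lebesgue. v s * of_real (F s)) \<le> 2 * c * ?V"
  proof -
    have "cmod (LINT s|lebesgue. v s * of_real (F s)) \<le> (LINT s|lebesgue. cmod (v s * of_real (F s)))"
      by (rule integral_norm_bound)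
    also have "\<dots> \<le> (LINT s|lebesgue. 2 * c * (indicat_real {0<..<2*pi} s *\<^sub>R cmod (v s)))"
    proof (rule integral_mono)
      show "integrable lebesgue (\<lambda>s. cmod (v s * of_real (F s)))"
        by (intro integrable_norm integrable_mult_test v Ftest)
      show "cmod (v s * of_real (F s)) \<le> 2 * c * (indicat_real {0<..<2*pi} s *\<^sub>R cmod (v s))" for s
      proof (cases "s \<in> {0<..<2*pi}")
        case True
        have "\<bar>F s\<bar> \<le> 2 * c" using F(4)[of s] fabs by linarith
        from mult_right_mono[OF this, of "cmod (v s)"] show ?thesis
          using True by (simp add: norm_mult mult.commute)
      qed (simp add: Fsupp)
    qed (use vint in auto)
    also have "\<dots> = 2 * c * ?V"
      by (simp add: set_lebesgue_integral_def)
    finally show ?thesis .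
  qed
  moreover have "(LINT s|lebesgue. w s * of_real (\<phi> s)) = c * ?W + (LINT s|lebesgue. w s * of_real (f s))"
  proof -
    have "(LINT s|lebesgue. w s * of_real (f s)) = (LINT s|lebesgue. w s * of_real (\<phi> s) - c * (w s * of_real (\<eta> s)))"
      by (rule Bochner_Integration.integral_cong) (auto simp: f_def algebra_simps)
    also have "\<dots> = (LINT s|lebesgue. w s * of_real (\<phi> s)) - c * ?W"
      using integrable_mult_test[OF w \<phi>] integrable_mult_test[OF w \<eta>(1)] by simp
    finally show ?thesis by simp
  qed
  ultimately have "cmod (LINT s|lebesgue. w s * of_real (\<phi> s)) \<le> c * cmod ?W + 2 * c * ?V"
    using norm_triangle_ineq4[of "c * ?W" "LINT s|lebesgue. v s * of_real (F s)"] \<open>c \<ge> 0\<close>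
    by (simp add: norm_mult)
  then show "cmod (LINT s|lebesgue. w s * of_real (\<phi> s)) \<le> (cmod ?W + 2 * ?V) * (LINT s|lebesgue. \<phi> s)"
    by (simp add: c_def algebra_simps)
qed

text \<open>
  Cauchy-Schwarz on an interval of length \<open>2 \<pi>\<close>, with a crude constant.
\<close>

lemma L1_le_L2_norm:
  assumes g: "loc_square_integrable g"
  shows "(LINT s:{0<..<2*pi}|lebesgue. cmod (g s)) \<le> 5 * L2_norm g"
proof -
  let ?I = "{0<..<2*pi} :: real set"
  let ?A = "LINT s:?I|lebesgue. cmod (g s)"
  let ?Q = "LINT s:?I|lebesgue. (cmod (g s))\<^sup>2"
  have sq: "set_integrable lebesgue ?I (\<lambda>s. (cmod (g s))\<^sup>2)"
    by (rule set_integrable_subset[of _ "{0..2*pi}"]) (use g in \<open>auto simp: loc_square_integrable_def\<close>)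
  have ab: "set_integrable lebesgue ?I (\<lambda>s. cmod (g s))"
    by (rule set_integrable_norm, rule set_integrable_subset[of _ "{0..2*pi}"])
      (use loc_integrable_Icc[OF loc_square_integrable_imp_loc_integrable[OF g]] in auto)
  have one: "set_integrable lebesgue ?I (\<lambda>s. c)" for c :: real
    by (rule set_integrable_subset[of _ "{0..2*pi}"])
      (auto simp: set_integrable_def integrable_indicator_Icc)
  have Q0: "?Q \<ge> 0" 
    unfolding set_lebesgue_integral_def by (rule integral_nonneg_AE) simp
  then have Q: "?Q = (L2_norm g)\<^sup>2" and N0: "L2_norm g \<ge> 0"
    by (auto simp: L2_norm_def)
  \<comment> \<open>Young's inequality with a free parameter \<open>t\<close>, to be chosen as the \<open>L\<^sup>2\<close> norm.\<close>
  have key: "?A \<le> pi * t + ?Q / (2 * t)" if "t > 0" for t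
  proof -
    have "?A \<le> (LINT s:?I|lebesgue. t / 2 + 1 / (2 * t) * (cmod (g s))\<^sup>2)"
    proof (rule set_integral_mono[OF ab])
      show "set_integrable lebesgue ?I (\<lambda>s. t / 2 + 1 / (2 * t) * (cmod (g s))\<^sup>2)"
        by (intro set_integral_add set_integrable_mult_right sq one)
      show "cmod (g s) \<le> t / 2 + 1 / (2 * t) * (cmod (g s))\<^sup>2" for s
        using zero_le_power2[of "t - cmod (g s)"] that
        by (simp add: field_simps power2_eq_square)
    qed
    also have "\<dots> = (LINT s:?I|lebesgue. t / 2) + (LINT s:?I|lebesgue. 1 / (2 * t) * (cmod (g s))\<^sup>2)"
      by (intro set_integral_add set_integrable_mult_right sq one)
    also have "\<dots> = pi * t + ?Q / (2 * t)"
      by (simp add: set_lebesgue_integral_def)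
    finally show ?thesis .
  qed
  show ?thesis
  proof (cases "L2_norm g = 0")
    case True
    have "?A \<le> 0"
    proof (rule field_le_epsilon)
      fix e :: real assume "e > 0"
      then show "?A \<le> 0 + e" using key[of "e / pi"] Q True by simp
    qed
    then show ?thesis using True by simp
  next
    case False
    then have "?A \<le> pi * L2_norm g + L2_norm g / 2"
      using key[of "L2_norm g"] N0 Q by (simp add: power2_eq_square)
    also have "\<dots> \<le> 4 * L2_norm g + L2_norm g / 2"
      using pi_less_4 N0 by (intro add_mono mult_right_mono) auto
    finally show ?thesis using N0 by linarith
  qed
qed

lemma weak_deriv_props:
  assumes "w \<in> H2per" "j \<le> 2"
  shows "loc_square_integrable (weak_deriv j w)" "has_weak_deriv j w (weak_deriv j w)"
proof -
  have "\<exists>v. loc_square_integrable v \<and> has_weak_deriv j w v"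
    using assms by (auto simp: H2per_def)
  from someI_ex[OF this] show "loc_square_integrable (weak_deriv j w)" "has_weak_deriv j w (weak_deriv j w)"
    by (auto simp: weak_deriv_def)
qed

lemma L2_norm_weak_deriv_le:
  assumes "j \<le> 2" shows "L2_norm (weak_deriv j w) \<le> H2_norm w"
proof -
  have "(L2_norm (weak_deriv j w))\<^sup>2 \<le> (\<Sum>j\<le>2. (L2_norm (weak_deriv j w))\<^sup>2)"
    using assms by (intro member_le_sum) auto
  then show ?thesis
    unfolding H2_norm_def by (rule real_le_rsqrt)
qed

lemma AE_lebesgue_shift:
  fixes P :: "real \<Rightarrow> bool"
  assumes "AE s in lebesgue. P s"
  shows "AE s in lebesgue. P (s + c)"
proof -
  obtain N where N: "{s. \<not> P s} \<subseteq> N" "N \<in> null_sets lebesgue"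
    using assms by (auto elim!: AE_E simp: null_sets_def)
  have "negligible ((+) (- c) ` N)"
    using N(2) by (intro negligible_translation) (simp add: negligible_iff_null_sets)
  moreover have "{s. \<not> P (s + c)} \<subseteq> (+) (- c) ` N"
    using N(1) by (force simp: image_iff)
  ultimately show ?thesis
    by (intro AE_I'[of "(+) (- c) ` N"]) (auto simp: negligible_iff_null_sets)
qed

lemma AE_periodic_shift:
  fixes w :: "real \<Rightarrow> complex"
  assumes per: "AE s in lebesgue. w (s + 2 * pi) = w s"
  shows "AE s in lebesgue. w (s + 2 * pi * of_int j) = w s"
proof -
  have nat: "AE s in lebesgue. w (s + 2 * pi * real n) = w s" for n
  proof (induction n)
    case (Suc n)
    from Suc AE_lebesgue_shift[OF per, of "2 * pi * real n"] show ?case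
      by eventually_elim (simp add: algebra_simps)
  qed simp
  show ?thesis
  proof (cases j rule: int_cases2)
    case (nonneg n) then show ?thesis using nat[of n] by simp
  next
    case (nonpos n)
    from AE_lebesgue_shift[OF nat[of n], of "- (2 * pi * real n)"] show ?thesis
      using nonpos by (auto elim!: eventually_mono)
  qed
qed

text \<open>
  Up to a countable set, each point is a translate by a multiple of \<open>2 \<pi>\<close> of a point of the open
  fundamental interval, and countably many null sets are discarded.
\<close>

lemma AE_periodic_bound:
  fixes w :: "real \<Rightarrow> complex"
  assumes per: "AE s in lebesgue. w (s + 2 * pi) = w s"
    and bound: "AE s in lebesgue. s \<in> {0<..<2*pi} \<longrightarrow> cmod (w s) \<le> M"
  shows "AE s in lebesgue. cmod (w s) \<le> M"
proof -
  have shifts: "AE s in lebesgue. \<forall>j::int. w (s + 2 * pi * of_int j) = w s"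
    using AE_periodic_shift[OF per] by (subst AE_all_countable) blast
  have bounds: "AE s in lebesgue. \<forall>j::int. s + 2 * pi * of_int j \<in> {0<..<2*pi} \<longrightarrow>
      cmod (w (s + 2 * pi * of_int j)) \<le> M"
    using AE_lebesgue_shift[OF bound] by (subst AE_all_countable) blast
  \<comment> \<open>The endpoints of the translated fundamental intervals.\<close>
  have "AE s in lebesgue. s \<notin> range (\<lambda>j::int. 2 * pi * of_int j)"
  proof (rule AE_not_in)
    have "countable (range (\<lambda>j::int. 2 * pi * real_of_int j))" by simp
    then show "range (\<lambda>j::int. 2 * pi * real_of_int j) \<in> null_sets lebesgue"
      by (intro null_sets_completionI countable_imp_null_set_lborel)
  qed
  with shifts bounds show ?thesis
  proof eventually_elim
    case (elim s)
    \<comment> \<open>The translate by \<open>n\<close> periods moves \<open>s\<close> into the fundamental interval.\<close>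
    obtain n :: int where "of_int n \<le> s / (2 * pi)" "s / (2 * pi) < of_int n + 1"
      by (rule that[of "\<lfloor>s / (2 * pi)\<rfloor>"]) linarith+
    then have n: "of_int n * (2 * pi) \<le> s" "s < (of_int n + 1) * (2 * pi)"
      by (metis pi_gt_zero pos_le_divide_eq zero_less_mult_iff zero_less_numeral,
          metis pi_gt_zero pos_divide_less_eq zero_less_mult_iff zero_less_numeral)
    define j where "j = - n"
    have "2 * pi * of_int j = - (of_int n * (2 * pi))"
      by (simp add: j_def)
    moreover have "(of_int n + 1) * (2 * pi) = of_int n * (2 * pi) + 2 * pi"
      by (simp only: distrib_right mult_1_left)
    ultimately have "0 \<le> s + 2 * pi * of_int j" "s + 2 * pi * of_int j < 2 * pi"
      using n by linarith+
    moreover have "s + 2 * pi * of_int j \<noteq> 0"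
    proof
      assume "s + 2 * pi * of_int j = 0"
      then have "s = 2 * pi * of_int (- j)" by simp
      with elim(3) show False by blast
    qed
    ultimately show ?case
      using elim(1)[rule_format, of j] elim(2)[rule_format, of j] by auto
  qed
qed

text \<open>
  The embedding makes the cubic nonlinearity differentiable: convergence in
  the Sobolev norm is uniform up to null sets.
\<close>

lemma sobolev_embedding:
  obtains C where "C \<ge> 0" "\<And>w. w \<in> H2per \<Longrightarrow> AE s in lebesgue. cmod (w s) \<le> C * H2_norm w"
proof -
  obtain \<eta> where \<eta>: "test_function \<eta>" "\<And>x. \<eta> x \<ge> 0" "\<And>x. x \<notin> {0<..<2*pi} \<Longrightarrow> \<eta> x = 0"
    "(LINT s|lebesgue. \<eta> s) = 1"
    using standard_bump by metis
  obtain B where B: "B > 0" "\<And>x. \<bar>\<eta> x\<bar> \<le> B"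
    using test_function_bounded[OF \<eta>(1)] by metis
  show thesis
  proof
    show "5 * B + 10 \<ge> 0" using B by simp
    fix w assume w: "w \<in> H2per"
    define p where "p = weak_deriv 0 w"
    define v where "v = weak_deriv 1 w"
    have p: "loc_square_integrable p" "has_weak_deriv 0 w p" and v: "loc_square_integrable v" "has_weak_deriv 1 w v"
      using weak_deriv_props[OF w] by (auto simp: p_def v_def)
    have wi: "loc_integrable w"
      using w by (simp add: H2per_def loc_square_integrable_imp_loc_integrable)
    let ?I = "{0<..<2*pi} :: real set"
    have "(LINT s|lebesgue. w s * of_real (\<eta> s)) = (LINT s|lebesgue. p s * of_real (\<eta> s))"
      using p(2) \<eta>(1) by (simp add: has_weak_deriv_def)
    also have "cmod \<dots> \<le> (LINT s|lebesgue. cmod (p s * of_real (\<eta> s)))"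
      by (rule integral_norm_bound)
    also have "\<dots> \<le> (LINT s|lebesgue. B * (indicat_real ?I s *\<^sub>R cmod (p s)))"
    proof (rule integral_mono)
      show "integrable lebesgue (\<lambda>s. cmod (p s * of_real (\<eta> s)))"
        by (intro integrable_norm integrable_mult_test \<eta>(1) loc_square_integrable_imp_loc_integrable p)
      have "set_integrable lebesgue ?I (\<lambda>s. cmod (p s))"
        by (rule set_integrable_norm, rule set_integrable_subset[of _ "{0..2*pi}"])
          (use loc_integrable_Icc[OF loc_square_integrable_imp_loc_integrable[OF p(1)]] in auto)
      then show "integrable lebesgue (\<lambda>s. B * (indicat_real ?I s *\<^sub>R cmod (p s)))"
        unfolding set_integrable_def by (rule integrable_mult_right)
      show "cmod (p s * of_real (\<eta> s)) \<le> B * (indicat_real ?I s *\<^sub>R cmod (p s))" for s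
        using mult_right_mono[OF B(2)[of s], of "cmod (p s)"] \<eta>(3)[of s]
        by (cases "s \<in> ?I") (auto simp: norm_mult mult.commute)
    qed
    also have "\<dots> = B * (LINT s:?I|lebesgue. cmod (p s))"
      by (simp add: set_lebesgue_integral_def)
    also have "\<dots> \<le> B * (5 * H2_norm w)"
      using L1_le_L2_norm[OF p(1)] L2_norm_weak_deriv_le[of 0 w] B
      by (intro mult_left_mono) (auto simp: p_def)
    finally have 1: "cmod (LINT s|lebesgue. w s * of_real (\<eta> s)) \<le> B * (5 * H2_norm w)" .
    have 2: "(LINT s:?I|lebesgue. cmod (v s)) \<le> 5 * H2_norm w"
      using L1_le_L2_norm[OF v(1)] L2_norm_weak_deriv_le[of 1 w] by (auto simp: v_def)
    have sup: "AE s in lebesgue. s \<in> ?I \<longrightarrow> cmod (w s) \<le>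
        cmod (LINT s|lebesgue. w s * of_real (\<eta> s)) + 2 * (LINT s:?I|lebesgue. cmod (v s))"
      by (rule has_weak_deriv_bound[OF wi loc_square_integrable_imp_loc_integrable[OF v(1)] v(2)]; fact \<eta>)
    have "AE s in lebesgue. s \<in> ?I \<longrightarrow> cmod (w s) \<le> (5 * B + 10) * H2_norm w"
      using sup
    proof eventually_elim
      case (elim s)
      then show ?case using 1 2 by (auto simp: algebra_simps)
    qed
    then show "AE s in lebesgue. cmod (w s) \<le> (5 * B + 10) * H2_norm w"
      using w by (intro AE_periodic_bound) (simp_all add: H2per_def)
  qed
qed

section \<open>Differentiable curves of essentially bounded functions\<close>

definition ess_bounded :: "(real \<Rightarrow> complex) \<Rightarrow> bool" where
  "ess_bounded g \<longleftrightarrow> g \<in> borel_measurable lebesgue \<and> (\<exists>M. AE s in lebesgue. cmod (g s) \<le> M)"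

lemma ess_boundedE:
  assumes "ess_bounded g"
  obtains M where "M \<ge> 0" "AE s in lebesgue. cmod (g s) \<le> M"
proof -
  obtain M where "AE s in lebesgue. cmod (g s) \<le> M"
    using assms by (auto simp: ess_bounded_def)
  then have "AE s in lebesgue. cmod (g s) \<le> max M 0"
    by eventually_elim simp
  then show thesis by (rule that[rotated]) simp
qed

lemma ess_bounded_measurable [measurable_dest]:
  "ess_bounded g \<Longrightarrow> g \<in> borel_measurable lebesgue"
  by (simp add: ess_bounded_def)

lemma ess_boundedI:
  "g \<in> borel_measurable lebesgue \<Longrightarrow> (AE s in lebesgue. cmod (g s) \<le> M) \<Longrightarrow> ess_bounded g"
  by (auto simp: ess_bounded_def)

lemma ess_bounded_mult:
  assumes "ess_bounded g" "ess_bounded h"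
  shows "ess_bounded (\<lambda>s. g s * h s)"
proof -
  obtain M where M: "M \<ge> 0" "AE s in lebesgue. cmod (g s) \<le> M" using assms(1) by (rule ess_boundedE)
  obtain K where K: "K \<ge> 0" "AE s in lebesgue. cmod (h s) \<le> K" using assms(2) by (rule ess_boundedE)
  have "AE s in lebesgue. cmod (g s * h s) \<le> M * K"
    using M(2) K(2) by eventually_elim (use M(1) K(1) in \<open>auto simp: norm_mult intro!: mult_mono\<close>)
  then show ?thesis
    using assms by (intro ess_boundedI) (auto intro!: borel_measurable_times simp: ess_bounded_def)
qed

lemma ess_bounded_add:
  assumes "ess_bounded g" "ess_bounded h"
  shows "ess_bounded (\<lambda>s. g s + h s)"
proof -
  obtain M where M: "M \<ge> 0" "AE s in lebesgue. cmod (g s) \<le> M" using assms(1) by (rule ess_boundedE)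
  obtain K where K: "K \<ge> 0" "AE s in lebesgue. cmod (h s) \<le> K" using assms(2) by (rule ess_boundedE)
  have "AE s in lebesgue. cmod (g s + h s) \<le> M + K"
    using M(2) K(2) by eventually_elim (metis add_mono norm_triangle_le)
  then show ?thesis
    using assms by (intro ess_boundedI) (auto intro!: borel_measurable_add simp: ess_bounded_def)
qed

lemma ess_bounded_const: "ess_bounded (\<lambda>s. c)"
  by (rule ess_boundedI[of _ "cmod c"]) auto

lemma ess_bounded_cnj:
  assumes "ess_bounded g"
  shows "ess_bounded (\<lambda>s. cnj (g s))"
proof -
  have "(\<lambda>s. cnj (g s)) \<in> borel_measurable lebesgue"
    by (rule borel_measurable_continuous_on[where f = cnj])
      (use assms in \<open>auto simp: ess_bounded_def intro: continuous_intros\<close>)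
  then show ?thesis
    using assms by (auto simp: ess_bounded_def)
qed

lemma ess_bounded_integrable_mult:
  fixes g h :: "real \<Rightarrow> complex"
  assumes g: "ess_bounded g" and h: "integrable lebesgue h"
  shows "integrable lebesgue (\<lambda>s. g s * h s)"
proof -
  obtain M where M: "M \<ge> 0" "AE s in lebesgue. cmod (g s) \<le> M" using g by (rule ess_boundedE)
  show ?thesis
  proof (rule Bochner_Integration.integrable_bound)
    show "integrable lebesgue (\<lambda>s. of_real M * h s)"
      using h by simp
    show "(\<lambda>s. g s * h s) \<in> borel_measurable lebesgue"
      using g h by (intro borel_measurable_times) (auto simp: ess_bounded_def)
    show "AE s in lebesgue. cmod (g s * h s) \<le> cmod (of_real M * h s)"
      using M(2) by eventually_elim (use M(1) in \<open>auto simp: norm_mult intro: mult_right_mono\<close>)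
  qed
qed

lemma integrable_indicator_complex: "integrable lebesgue (\<lambda>s. indicator {a..b::real} s :: complex)"
proof -
  have "integrable lebesgue (\<lambda>s. complex_of_real (indicator {a..b::real} s))"
    using integrable_indicator_Icc by (simp only: complex_of_real_integrable_eq)
  moreover have "complex_of_real (indicator {a..b} s) = indicator {a..b} s" for s :: real
    by (simp add: indicator_def)
  ultimately show ?thesis by simp
qed

lemma ess_bounded_imp_loc_square_integrable:
  assumes g: "ess_bounded g"
  shows "loc_square_integrable g"
  unfolding loc_square_integrable_def
proof (intro conjI allI impI)
  show "g \<in> borel_measurable lebesgue" using g by (simp add: ess_bounded_def)
  fix K :: "real set" assume K: "compact K"
  obtain R where "\<forall>x\<in>K. norm x \<le> R"
    using compact_imp_bounded[OF K] by (auto simp: bounded_iff)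
  then have R: "K \<subseteq> {-R..R}"
    by (auto simp: abs_le_iff minus_le_iff)
  have "integrable lebesgue (\<lambda>s. (g s * cnj (g s)) * indicator {-R..R} s)"
    by (intro ess_bounded_integrable_mult ess_bounded_mult ess_bounded_cnj g integrable_indicator_complex)
  then have "integrable lebesgue (\<lambda>s. Re ((g s * cnj (g s)) * indicator {-R..R} s))"
    by (rule integrable_Re)
  moreover have "Re ((g s * cnj (g s)) * indicator {-R..R} s) = indicator {-R..R} s *\<^sub>R (cmod (g s))\<^sup>2" for s
    by (auto simp: indicator_def complex_norm_square[symmetric])
  ultimately have "set_integrable lebesgue {-R..R} (\<lambda>s. (cmod (g s))\<^sup>2)"
    by (simp add: set_integrable_def)
  then show "set_integrable lebesgue K (\<lambda>s. (cmod (g s))\<^sup>2)"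
    by (rule set_integrable_subset) (use K R in \<open>auto simp: borel_compact\<close>)
qed

lemma ess_bounded_imp_loc_integrable: "ess_bounded g \<Longrightarrow> loc_integrable g"
  by (simp add: ess_bounded_imp_loc_square_integrable loc_square_integrable_imp_loc_integrable)

text \<open>
  Differentiability of a curve with difference quotients converging in \<open>L\<^sup>\<infinity>\<close>. In this algebra the product
  rule holds, and the cubic term and the squared \<open>L\<^sup>2\<close> norm are both built from products. The bound \<open>b h\<close> stands
  for the essential supremum of the error.
\<close>

definition has_ess_derivative ::
  "(real \<Rightarrow> real \<Rightarrow> complex) \<Rightarrow> (real \<Rightarrow> complex) \<Rightarrow> real \<Rightarrow> bool" where
  "has_ess_derivative A A' f \<longleftrightarrow>
     ess_bounded (A f) \<and> ess_bounded A' \<and> (\<forall>\<^sub>F h in at 0. ess_bounded (A (f + h))) \<and>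
     (\<exists>b. (b \<longlongrightarrow> 0) (at 0) \<and>
       (\<forall>\<^sub>F h in at 0. AE s in lebesgue. cmod ((A (f + h) s - A f s) /\<^sub>R h - A' s) \<le> b h))"

lemma has_ess_derivative_cnj:
  assumes "has_ess_derivative A A' f"
  shows "has_ess_derivative (\<lambda>f s. cnj (A f s)) (\<lambda>s. cnj (A' s)) f"
proof -
  have *: "cmod ((cnj p - cnj q) /\<^sub>R h - cnj r) = cmod ((p - q) /\<^sub>R h - r)" for p q r h
    by (metis complex_cnj_diff complex_cnj_scaleR complex_mod_cnj)
  have "\<forall>\<^sub>F h in at 0. ess_bounded (\<lambda>s. cnj (A (f + h) s))"
    using assms unfolding has_ess_derivative_def by (auto elim!: eventually_mono intro: ess_bounded_cnj)
  then show ?thesis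
    using assms unfolding has_ess_derivative_def * by (auto intro: ess_bounded_cnj)
qed

lemma has_ess_derivative_add:
  assumes A: "has_ess_derivative A A' f" and B: "has_ess_derivative B B' f"
  shows "has_ess_derivative (\<lambda>f s. A f s + B f s) (\<lambda>s. A' s + B' s) f"
proof -
  obtain a where a: "(a \<longlongrightarrow> 0) (at 0)"
    "\<forall>\<^sub>F h in at 0. AE s in lebesgue. cmod ((A (f + h) s - A f s) /\<^sub>R h - A' s) \<le> a h"
    using A by (auto simp: has_ess_derivative_def)
  obtain b where b: "(b \<longlongrightarrow> 0) (at 0)"
    "\<forall>\<^sub>F h in at 0. AE s in lebesgue. cmod ((B (f + h) s - B f s) /\<^sub>R h - B' s) \<le> b h"
    using B by (auto simp: has_ess_derivative_def)
  have "\<forall>\<^sub>F h in at 0. AE s in lebesgue.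
      cmod (((A (f + h) s + B (f + h) s) - (A f s + B f s)) /\<^sub>R h - (A' s + B' s)) \<le> a h + b h"
    using a(2) b(2)
  proof eventually_elim
    case (elim h)
    then show ?case
    proof eventually_elim
      case (elim s)
      have "((A (f + h) s + B (f + h) s) - (A f s + B f s)) /\<^sub>R h - (A' s + B' s) =
          ((A (f + h) s - A f s) /\<^sub>R h - A' s) + ((B (f + h) s - B f s) /\<^sub>R h - B' s)"
        by (simp add: algebra_simps)
      then show ?case using elim by (metis add_mono norm_triangle_le)
    qed
  qed
  moreover have "((\<lambda>h. a h + b h) \<longlongrightarrow> 0) (at 0)"
    using tendsto_add[OF a(1) b(1)] by simp
  moreover have "\<forall>\<^sub>F h in at 0. ess_bounded (\<lambda>s. A (f + h) s + B (f + h) s)"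
    using A B unfolding has_ess_derivative_def by (auto elim: eventually_elim2 intro: ess_bounded_add)
  ultimately show ?thesis
    using A B unfolding has_ess_derivative_def by (auto intro!: ess_bounded_add exI[of _ "\<lambda>h. a h + b h"])
qed

text \<open>
  If \<open>p\<close> and \<open>q\<close> are the errors of the two difference quotients, then the error for the product is
  \<open>A q + p B + h (A' + p) (B' + q)\<close>.
\<close>

lemma has_ess_derivative_mult:
  assumes A: "has_ess_derivative A A' f" and B: "has_ess_derivative B B' f"
  shows "has_ess_derivative (\<lambda>f s. A f s * B f s) (\<lambda>s. A' s * B f s + A f s * B' s) f"
proof -
  obtain a where a: "(a \<longlongrightarrow> 0) (at 0)"
    "\<forall>\<^sub>F h in at 0. AE s in lebesgue. cmod ((A (f + h) s - A f s) /\<^sub>R h - A' s) \<le> a h"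
    using A by (auto simp: has_ess_derivative_def)
  obtain b where b: "(b \<longlongrightarrow> 0) (at 0)"
    "\<forall>\<^sub>F h in at 0. AE s in lebesgue. cmod ((B (f + h) s - B f s) /\<^sub>R h - B' s) \<le> b h"
    using B by (auto simp: has_ess_derivative_def)
  obtain M where M: "M \<ge> 0" "AE s in lebesgue. cmod (A f s) \<le> M"
    using A ess_boundedE unfolding has_ess_derivative_def by metis
  obtain M' where M': "M' \<ge> 0" "AE s in lebesgue. cmod (A' s) \<le> M'"
    using A ess_boundedE unfolding has_ess_derivative_def by metis
  obtain K where K: "K \<ge> 0" "AE s in lebesgue. cmod (B f s) \<le> K"
    using B ess_boundedE unfolding has_ess_derivative_def by metis
  obtain K' where K': "K' \<ge> 0" "AE s in lebesgue. cmod (B' s) \<le> K'"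
    using B ess_boundedE unfolding has_ess_derivative_def by metis
  define c where "c h = M * b h + a h * K + \<bar>h\<bar> * ((M' + a h) * (K' + b h))" for h
  have nz: "\<forall>\<^sub>F h in at (0::real). h \<noteq> 0"
    by (simp add: eventually_at_filter)
  have "\<forall>\<^sub>F h in at 0. AE s in lebesgue.
      cmod ((A (f + h) s * B (f + h) s - A f s * B f s) /\<^sub>R h - (A' s * B f s + A f s * B' s)) \<le> c h"
    using a(2) b(2) nz
  proof eventually_elim
    case (elim h)
    from elim(1,2) M(2) M'(2) K(2) K'(2) show ?case
    proof eventually_elim
      case (elim s)
      define p where "p = (A (f + h) s - A f s) /\<^sub>R h - A' s"
      define q where "q = (B (f + h) s - B f s) /\<^sub>R h - B' s"
      have Ah: "A (f + h) s = A f s + of_real h * (A' s + p)" and Bh: "B (f + h) s = B f s + of_real h * (B' s + q)"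
        using \<open>h \<noteq> 0\<close> by (auto simp: p_def q_def scaleR_conv_of_real field_simps)
      have "(A (f + h) s * B (f + h) s - A f s * B f s) /\<^sub>R h - (A' s * B f s + A f s * B' s) =
          A f s * q + p * B f s + of_real h * ((A' s + p) * (B' s + q))"
        unfolding Ah Bh using \<open>h \<noteq> 0\<close> by (simp add: scaleR_conv_of_real field_simps)
      also have "cmod \<dots> \<le> cmod (A f s) * cmod q + cmod p * cmod (B f s) +
          \<bar>h\<bar> * ((cmod (A' s) + cmod p) * (cmod (B' s) + cmod q))"
        by (intro norm_triangle_le add_mono)
          (auto simp: norm_mult intro!: mult_left_mono mult_mono norm_triangle_ineq)
      also have "\<dots> \<le> c h"
      proof -
        have pq: "cmod p \<le> a h" "cmod q \<le> b h" using elim by (auto simp: p_def q_def)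
        then have "0 \<le> a h" "0 \<le> b h" using norm_ge_zero order_trans by blast+
        with pq elim M(1) M'(1) K(1) K'(1) show ?thesis
          unfolding c_def by (intro add_mono mult_mono) auto
      qed
      finally show ?case .
    qed
  qed
  moreover have "(c \<longlongrightarrow> M * 0 + 0 * K + \<bar>0\<bar> * ((M' + 0) * (K' + 0))) (at 0)"
    unfolding c_def by (intro tendsto_intros a(1) b(1))
  moreover have "\<forall>\<^sub>F h in at 0. ess_bounded (\<lambda>s. A (f + h) s * B (f + h) s)"
    using A B unfolding has_ess_derivative_def by (auto elim: eventually_elim2 intro: ess_bounded_mult)
  ultimately show ?thesis
    using A B unfolding has_ess_derivative_def
    by (auto intro!: ess_bounded_add ess_bounded_mult exI[of _ c])
qed

text \<open>
  Pairing with an integrable weight turns curves of functions into curves of numbers, for which derivatives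
  are unique and vanish if the curve is constant.
\<close>

lemma has_ess_derivative_integral:
  assumes A: "has_ess_derivative A A' f" and g: "integrable lebesgue g"
  shows "((\<lambda>f. LINT s|lebesgue. A f s * g s) has_vector_derivative (LINT s|lebesgue. A' s * g s)) (at f)"
proof -
  obtain b where b: "(b \<longlongrightarrow> 0) (at 0)"
    "\<forall>\<^sub>F h in at 0. AE s in lebesgue. cmod ((A (f + h) s - A f s) /\<^sub>R h - A' s) \<le> b h"
    using A by (auto simp: has_ess_derivative_def)
  let ?F = "\<lambda>f. LINT s|lebesgue. A f s * g s" and ?D = "LINT s|lebesgue. A' s * g s"
  let ?G = "LINT s|lebesgue. cmod (g s)"
  have nz: "\<forall>\<^sub>F h in at (0::real). h \<noteq> 0"
    by (simp add: eventually_at_filter)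
  have bd: "ess_bounded (A f)" "ess_bounded A'" "\<forall>\<^sub>F h in at 0. ess_bounded (A (f + h))"
    using A by (auto simp: has_ess_derivative_def)
  have "\<forall>\<^sub>F h in at 0. norm (norm (?F (f + h) - ?F f - h *\<^sub>R ?D) / norm h) \<le> b h * ?G"
    using b(2) bd(3) nz
  proof eventually_elim
    case (elim h)
    note int = ess_bounded_integrable_mult[OF elim(2) g] ess_bounded_integrable_mult[OF bd(1) g]
      ess_bounded_integrable_mult[OF bd(2) g]
    let ?q = "\<lambda>s. ((A (f + h) s - A f s) /\<^sub>R h - A' s) * g s"
    have eq: "?q s = (A (f + h) s * g s - A f s * g s) /\<^sub>R h - A' s * g s" for s
      by (simp add: algebra_simps)
    have qi: "integrable lebesgue ?q"
      unfolding eq using int by simp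
    have "?F (f + h) - ?F f - h *\<^sub>R ?D = h *\<^sub>R (LINT s|lebesgue. ?q s)"
      unfolding eq using int elim(3) by (simp add: scaleR_right_diff_distrib)
    then have "norm (norm (?F (f + h) - ?F f - h *\<^sub>R ?D) / norm h) = cmod (LINT s|lebesgue. ?q s)"
      using elim(3) by simp
    also have "\<dots> \<le> (LINT s|lebesgue. cmod (?q s))"
      by (rule integral_norm_bound)
    also have "\<dots> \<le> (LINT s|lebesgue. b h * cmod (g s))"
    proof (rule integral_mono_AE)
      show "AE s in lebesgue. cmod (?q s) \<le> b h * cmod (g s)"
        using elim(1) by eventually_elim (auto simp: norm_mult intro!: mult_right_mono)
    qed (use qi g in auto)
    also have "\<dots> = b h * ?G" by simp
    finally show ?case .
  qed
  moreover have "((\<lambda>h. b h * ?G) \<longlongrightarrow> 0) (at 0)"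
    using tendsto_mult_right[OF b(1), of ?G] by simp
  ultimately have "((\<lambda>h. norm (?F (f + h) - ?F f - h *\<^sub>R ?D) / norm h) \<longlongrightarrow> 0) (at 0)"
    by (rule Lim_null_comparison)
  then show ?thesis
    unfolding has_vector_derivative_def has_derivative_at
    by (simp add: bounded_linear_scaleR_left)
qed

section \<open>The periodic Sobolev space\<close>

lemma test_function_funpow_deriv: "test_function \<phi> \<Longrightarrow> test_function ((deriv ^^ j) \<phi>)"
  by (induction j) (auto intro: test_function_deriv)

lemma H2per_loc_integrable: "w \<in> H2per \<Longrightarrow> loc_integrable w"
  by (simp add: H2per_def loc_square_integrable_imp_loc_integrable)

lemma has_weak_deriv_lincomb:
  assumes "loc_integrable w" "loc_integrable w'" "loc_integrable v" "loc_integrable v'"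
    and "has_weak_deriv j w v" "has_weak_deriv j w' v'"
  shows "has_weak_deriv j (\<lambda>s. a * w s + b * w' s) (\<lambda>s. a * v s + b * v' s)"
  unfolding has_weak_deriv_def
proof (intro allI impI)
  fix \<phi> assume \<phi>: "test_function \<phi>"
  note \<phi>' = test_function_funpow_deriv[OF \<phi>, of j]
  have lin: "(LINT s|lebesgue. (a * p s + b * q s) * of_real (\<theta> s)) =
      a * (LINT s|lebesgue. p s * of_real (\<theta> s)) + b * (LINT s|lebesgue. q s * of_real (\<theta> s))"
    if "loc_integrable p" "loc_integrable q" "test_function \<theta>" for p q \<theta>
    using integrable_mult_test[OF that(1,3)] integrable_mult_test[OF that(2,3)]
    by (simp add: ring_distribs mult.assoc)
  show "(LINT s|lebesgue. (a * w s + b * w' s) * of_real ((deriv ^^ j) \<phi> s)) =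
      (- 1) ^ j * (LINT s|lebesgue. (a * v s + b * v' s) * of_real (\<phi> s))"
    unfolding lin[OF assms(1,2) \<phi>'] lin[OF assms(3,4) \<phi>]
    using assms(5,6) \<phi> by (simp add: has_weak_deriv_def algebra_simps)
qed

lemma H2per_lincomb:
  assumes "v \<in> H2per" "w \<in> H2per"
  shows "(\<lambda>s. a * v s + b * w s) \<in> H2per"
  unfolding H2per_def
proof (intro CollectI conjI allI impI)
  show "loc_square_integrable (\<lambda>s. a * v s + b * w s)"
    using assms by (intro loc_square_integrable_lincomb) (auto simp: H2per_def)
  have "AE s in lebesgue. v (s + 2 * pi) = v s" "AE s in lebesgue. w (s + 2 * pi) = w s"
    using assms by (auto simp: H2per_def)
  then show "AE s in lebesgue. a * v (s + 2 * pi) + b * w (s + 2 * pi) = a * v s + b * w s"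
    by eventually_elim simp
  fix j :: nat assume j: "j \<le> 2"
  show "\<exists>p. loc_square_integrable p \<and> has_weak_deriv j (\<lambda>s. a * v s + b * w s) p"
    using weak_deriv_props[OF assms(1) j] weak_deriv_props[OF assms(2) j] assms
    by (intro exI[of _ "\<lambda>s. a * weak_deriv j v s + b * weak_deriv j w s"] conjI
        loc_square_integrable_lincomb has_weak_deriv_lincomb)
      (auto intro: H2per_loc_integrable loc_square_integrable_imp_loc_integrable)
qed

lemma H2per_ess_bounded: "w \<in> H2per \<Longrightarrow> ess_bounded w"
  by (metis sobolev_embedding ess_boundedI H2per_loc_integrable loc_integrable_measurable)

text \<open>
  The Sobolev embedding applied to the error of the difference quotient.
\<close>

lemma has_H2_derivative_imp_ess:
  assumes U: "has_H2_derivative U V f" "U f \<in> H2per" "V \<in> H2per" 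
    and near: "\<forall>\<^sub>F h in at 0. U (f + h) \<in> H2per"
  shows "has_ess_derivative U V f"
proof -
  obtain C where C: "\<And>w. w \<in> H2per \<Longrightarrow> AE s in lebesgue. cmod (w s) \<le> C * H2_norm w"
    using sobolev_embedding by metis
  \<comment> \<open>The error of the difference quotient is a linear combination of elements of the space.\<close>
  define q where "q h = (\<lambda>s. (U (f + h) s - U f s) /\<^sub>R h - V s)" for h
  have "\<forall>\<^sub>F h in at 0. AE s in lebesgue. cmod (q h s) \<le> C * H2_norm (q h)"
    using near
  proof eventually_elim
    case (elim h)
    have "q h = (\<lambda>s. 1 * (of_real (inverse h) * U (f + h) s + of_real (- inverse h) * U f s) + (- 1) * V s)"
      by (auto simp: q_def scaleR_conv_of_real algebra_simps)
    also have "\<dots> \<in> H2per"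
      by (intro H2per_lincomb U elim)
    finally show ?case by (rule C)
  qed
  moreover have "((\<lambda>h. C * H2_norm (q h)) \<longlongrightarrow> 0) (at 0)"
    using tendsto_mult_left[of "\<lambda>h. H2_norm (q h)" 0 "at 0" C] U(1)
    by (simp add: has_H2_derivative_def q_def)
  moreover have "\<forall>\<^sub>F h in at 0. ess_bounded (U (f + h))"
    using near by eventually_elim (rule H2per_ess_bounded)
  ultimately show ?thesis
    using U(2,3) unfolding has_ess_derivative_def q_def
    by (auto intro!: H2per_ess_bounded exI[of _ "\<lambda>h. C * H2_norm (q h)"] simp: q_def)
qed

text \<open>
  This makes the choice of a representative in \<open>weak_deriv\<close> harmless, so weak derivatives of explicit
  functions can be computed classically.
\<close>

lemma weak_deriv_unique:
  assumes w: "w \<in> H2per" "j \<le> 2" and v: "loc_square_integrable v" "has_weak_deriv j w v"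
  shows "AE s in lebesgue. weak_deriv j w s = v s"
proof -
  note p = weak_deriv_props[OF w]
  have li: "loc_integrable v" "loc_integrable (weak_deriv j w)"
    using v p by (auto intro: loc_square_integrable_imp_loc_integrable)
  have "AE s in lebesgue. weak_deriv j w s + (- 1) * v s = 0"
  proof (rule fundamental_lemma)
    show "loc_integrable (\<lambda>s. weak_deriv j w s + (- 1) * v s)"
      by (intro loc_integrable_add loc_integrable_cmult li)
    fix \<phi> assume \<phi>: "test_function \<phi>"
    have "(- 1) ^ j * (LINT s|lebesgue. weak_deriv j w s * of_real (\<phi> s)) =
        (- 1) ^ j * (LINT s|lebesgue. v s * complex_of_real (\<phi> s))"
      using v(2) p(2) \<phi> by (simp add: has_weak_deriv_def)
    then have "(LINT s|lebesgue. weak_deriv j w s * of_real (\<phi> s)) = (LINT s|lebesgue. v s * complex_of_real (\<phi> s))"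
      by simp
    then show "(LINT s|lebesgue. (weak_deriv j w s + (- 1) * v s) * of_real (\<phi> s)) = 0"
      using integrable_mult_test[OF li(1) \<phi>] integrable_mult_test[OF li(2) \<phi>] by (simp add: ring_distribs)
  qed
  then show ?thesis by eventually_elim simp
qed

section \<open>Trigonometric modes\<close>

definition mode :: "int \<Rightarrow> real \<Rightarrow> complex" where
  "mode k s = exp (\<i> * of_int k * of_real s)"

lemma mode_0 [simp]: "mode 0 s = 1"
  by (simp add: mode_def)

lemma mode_add: "mode (j + k) s = mode j s * mode k s"
  by (simp add: mode_def exp_add[symmetric] algebra_simps)

lemma cnj_mode: "cnj (mode k s) = mode (- k) s"
  by (simp add: mode_def exp_cnj)

lemma cmod_mode [simp]: "cmod (mode k s) = 1"
proof -
  have "mode k s = exp (\<i> * of_real (of_int k * s))"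
    by (simp add: mode_def mult.assoc)
  then show ?thesis by (simp only: norm_exp_i_times)
qed

lemma mode_periodic: "mode k (s + 2 * pi) = mode k s"
proof -
  have "mode k (s + 2 * pi) = exp (\<i> * of_int k * of_real s + of_int k * (of_real (2 * pi) * \<i>))"
    by (simp add: mode_def algebra_simps)
  also have "exp (complex_of_int k * (of_real (2 * pi) * \<i>)) = 1"
    using exp_integer_2pi[of "of_int k"] by (simp add: mult.commute mult.left_commute)
  ultimately show ?thesis
    by (simp add: exp_add mode_def)
qed

lemma mode_has_vector_derivative:
  "(mode k has_vector_derivative \<i> * of_int k * mode k s) (at s within A)"
proof -
  have "((\<lambda>s. exp (\<i> * of_int k * of_real s)) has_vector_derivative
      (\<i> * of_int k) * exp (\<i> * of_int k * of_real s)) (at s within A)"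
    by (rule has_vector_derivative_real_field)
      (auto intro!: derivative_eq_intros)
  then show ?thesis by (simp add: mode_def[abs_def])
qed

lemma continuous_on_mode: "continuous_on A (mode k)"
  unfolding mode_def by (intro continuous_intros)

lemma mode_measurable: "mode k \<in> borel_measurable lebesgue"
  by (intro borel_measurable_lebesgueI borel_measurable_continuous_onI continuous_on_mode)

lemma ess_bounded_mode: "ess_bounded (mode k)"
  by (rule ess_boundedI[OF mode_measurable, of _ 1]) simp

lemma integral_mode:
  assumes "k \<noteq> 0"
  shows "(LINT s:{0<..<2*pi}|lebesgue. mode k s) = 0"
proof -
  let ?F = "\<lambda>s. mode k s / (\<i> * of_int k)"
  have "(mode k has_integral ?F (2 * pi) - ?F 0) {0..2*pi}"
  proof (rule fundamental_theorem_of_calculus)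
    fix x
    have "(?F has_vector_derivative (\<i> * of_int k * mode k x) / (\<i> * of_int k)) (at x within {0..2*pi})"
      by (rule has_vector_derivative_divide[OF mode_has_vector_derivative])
    then show "(?F has_vector_derivative mode k x) (at x within {0..2*pi})"
      using assms by simp
  qed simp
  then have "(mode k has_integral 0) {0..2*pi}"
    using mode_periodic[of k 0] by simp
  then have "integral {0<..<2*pi} (mode k) = 0"
    by (simp only: integral_open_interval_real[symmetric] integral_unique)
  moreover have "set_integrable lebesgue {0<..<2*pi} (mode k)"
    by (rule set_integrable_subset[of _ "{0..2*pi}"])
      (auto intro!: loc_integrable_Icc ess_bounded_imp_loc_integrable ess_bounded_mode)
  ultimately show ?thesis
    by (simp add: set_lebesgue_integral_eq_integral)
qed

lemma integral_test_total_derivative: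
  assumes "\<And>x. (F has_vector_derivative f x) (at x)" "continuous_on UNIV f"
    and "\<And>x. x \<notin> {-R..R} \<Longrightarrow> F x = 0"
  shows "(LINT s|lebesgue. (f s :: complex)) = 0"
proof -
  define S where "S = \<bar>R\<bar> + 1"
  have fz: "f x = 0" if "x \<notin> {-R..R}" for x
  proof -
    have "(F has_vector_derivative 0) (at x)"
      by (rule has_vector_derivative_transform_within_open[where f = "\<lambda>_. 0" and S = "- {-R..R}"])
        (use that assms(3) in \<open>auto simp: open_Compl\<close>)
    then show ?thesis
      using assms(1) vector_derivative_unique_at by blast
  qed
  have "(LINT s|lborel. indicator {-S..S} s *\<^sub>R f s) = F S - F (-S)"
  proof (rule integral_FTC_Icc)
    show "- S \<le> S" by (simp add: S_def)
    show "(F has_vector_derivative f x) (at x within {-S..S})" for x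
      using assms(1) by (rule has_vector_derivative_at_within)
    show "continuous_on {-S..S} f"
      using assms(2) continuous_on_subset by blast
  qed
  moreover have "F S = 0" "F (-S) = 0"
    using assms(3)[of S] assms(3)[of "- S"] unfolding S_def by force+
  moreover have "(\<lambda>s. indicator {-S..S} s *\<^sub>R f s) = f"
  proof
    fix s show "indicator {-S..S} s *\<^sub>R f s = f s"
      using fz[of s] by (cases "s \<in> {-R..R}") (auto simp: S_def)
  qed
  ultimately have "(LINT s|lborel. f s) = 0"
    by simp
  moreover have "f \<in> borel_measurable borel"
    using assms(2) by (rule borel_measurable_continuous_onI)
  ultimately show ?thesis
    by (subst integral_completion) auto
qed

lemma mode_integration_by_parts:
  assumes \<phi>: "test_function \<phi>"
  shows "(LINT s|lebesgue. mode k s * of_real (deriv \<phi> s)) =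
    - (\<i> * of_int k * (LINT s|lebesgue. mode k s * of_real (\<phi> s)))"
proof -
  obtain R where R: "\<And>x. x \<notin> {-R..R} \<Longrightarrow> \<phi> x = 0"
    using test_function_support[OF \<phi>] by metis
  let ?f = "\<lambda>s. mode k s * of_real (deriv \<phi> s) + \<i> * of_int k * (mode k s * of_real (\<phi> s))"
  have "(LINT s|lebesgue. ?f s) = 0"
  proof (rule integral_test_total_derivative[where F = "\<lambda>s. mode k s * of_real (\<phi> s)" and R = R])
    from has_vector_derivative_mult[OF mode_has_vector_derivative
        has_vector_derivative_of_real[OF test_function_has_deriv[OF \<phi>]]]
    show "((\<lambda>s. mode k s * of_real (\<phi> s)) has_vector_derivative ?f x) (at x)" for x
      by (simp add: mult.assoc)
    show "continuous_on UNIV ?f"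
      by (intro continuous_intros continuous_on_mode test_function_continuous test_function_deriv \<phi>)
  qed (simp add: R)
  moreover have "integrable lebesgue (\<lambda>s. mode k s * of_real (\<phi> s))" "integrable lebesgue (\<lambda>s. mode k s * of_real (deriv \<phi> s))"
    by (intro integrable_mult_test ess_bounded_imp_loc_integrable ess_bounded_mode test_function_deriv \<phi>)+
  ultimately show ?thesis
    by (simp add: add_eq_0_iff2)
qed

lemma has_weak_deriv_mode:
  assumes "j \<le> 2"
  shows "has_weak_deriv j (mode k) (\<lambda>s. (\<i> * of_int k) ^ j * mode k s)"
  unfolding has_weak_deriv_def
proof (intro allI impI)
  have "(LINT s|lebesgue. mode k s * of_real ((deriv ^^ j) \<phi> s)) =
      (- 1) ^ j * ((\<i> * of_int k) ^ j * (LINT s|lebesgue. mode k s * of_real (\<phi> s)))"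
    if "test_function \<phi>" for \<phi> :: "real \<Rightarrow> real" and j
  proof (induction j)
    case (Suc j)
    then show ?case
      using mode_integration_by_parts[OF test_function_funpow_deriv[OF that, of j], of k] by simp
  qed simp
  moreover fix \<phi> assume "test_function \<phi>"
  ultimately show "(LINT s|lebesgue. mode k s * of_real ((deriv ^^ j) \<phi> s)) =
      (- 1) ^ j * (LINT s|lebesgue. (\<i> * of_int k) ^ j * mode k s * of_real (\<phi> s))"
    by (simp add: mult.assoc)
qed

lemma loc_square_integrable_cmult_mode: "loc_square_integrable (\<lambda>s. c * mode k s)"
  by (intro ess_bounded_imp_loc_square_integrable ess_bounded_mult ess_bounded_const ess_bounded_mode)

lemma mode_H2per: "mode k \<in> H2per"
  unfolding H2per_def
  using loc_square_integrable_cmult_mode[of 1 k] loc_square_integrable_cmult_mode has_weak_deriv_mode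
  by (fastforce simp: mode_periodic)

lemma weak_deriv_two_modes:
  assumes "j \<le> 2"
  shows "AE s in lebesgue. weak_deriv j (\<lambda>s. a * mode k s + b * mode l s) s =
    a * ((\<i> * of_int k) ^ j * mode k s) + b * ((\<i> * of_int l) ^ j * mode l s)"
proof (rule weak_deriv_unique[OF H2per_lincomb[OF mode_H2per mode_H2per] assms])
  show "loc_square_integrable (\<lambda>s. a * ((\<i> * of_int k) ^ j * mode k s) + b * ((\<i> * of_int l) ^ j * mode l s))"
    by (intro loc_square_integrable_lincomb loc_square_integrable_cmult_mode)
  show "has_weak_deriv j (\<lambda>s. a * mode k s + b * mode l s)
      (\<lambda>s. a * ((\<i> * of_int k) ^ j * mode k s) + b * ((\<i> * of_int l) ^ j * mode l s))"
    by (intro has_weak_deriv_lincomb has_weak_deriv_mode assms H2per_loc_integrable mode_H2per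
        loc_square_integrable_imp_loc_integrable loc_square_integrable_cmult_mode)
qed

text \<open>
  The antilinear term of the operator couples \<open>mode k\<close> to \<open>mode (- k)\<close>, so that the span of these two
  modes is invariant.
\<close>

lemma lin_op_two_modes:
  "AE s in lebesgue. lin_op d \<zeta> \<omega> u0 (\<lambda>s. a * mode k s + b * mode (- k) s) s =
    ((of_real d * of_int k ^ 2 - of_real \<omega> * of_int k + (of_real \<zeta> - \<i> - 2 * of_real ((cmod u0)\<^sup>2))) * a
       - u0\<^sup>2 * cnj b) * mode k s +
    ((of_real d * of_int k ^ 2 + of_real \<omega> * of_int k + (of_real \<zeta> - \<i> - 2 * of_real ((cmod u0)\<^sup>2))) * b
       - u0\<^sup>2 * cnj a) * mode (- k) s"
  using weak_deriv_two_modes[of 1 a k b "- k", OF one_le_numeral] weak_deriv_two_modes[of 2 a k b "- k", OF order_refl]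
proof eventually_elim
  case (elim s)
  have i2: "\<i> * (\<i> * c) = - c" for c
    by (simp add: mult.assoc[symmetric])
  show ?case
    unfolding lin_op_def using elim
    by (simp add: cnj_mode power_mult_distrib) (simp add: algebra_simps i2)
qed

lemma set_integral_two_modes:
  fixes a b c :: complex
  assumes "k \<noteq> 0"
  shows "(LINT s:{0<..<2*pi}|lebesgue. c + a * mode k s + b * mode (- k) s) = 2 * pi * c"
proof -
  have int: "set_integrable lebesgue {0<..<2*pi} (\<lambda>s. e * mode j s)" for e j
    by (rule set_integrable_subset[of _ "{0..2*pi}"])
      (auto intro!: loc_integrable_Icc ess_bounded_imp_loc_integrable ess_bounded_mult ess_bounded_const ess_bounded_mode)
  have "(LINT s:{0<..<2*pi}|lebesgue. c * mode 0 s + a * mode k s + b * mode (- k) s) =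
      (LINT s:{0<..<2*pi}|lebesgue. c * mode 0 s) + (LINT s:{0<..<2*pi}|lebesgue. a * mode k s)
      + (LINT s:{0<..<2*pi}|lebesgue. b * mode (- k) s)"
    by (simp only: set_integral_add int)
  moreover have scale: "(LINT s:{0<..<2*pi}|lebesgue. e * mode j s) = e * (LINT s:{0<..<2*pi}|lebesgue. mode j s)" for e j
    by (simp add: set_lebesgue_integral_def)
  moreover have "(LINT s:{0<..<2*pi}|lebesgue. mode 0 s) = 2 * of_real pi"
    by (simp add: set_lebesgue_integral_def scaleR_conv_of_real)
  ultimately show ?thesis
    using assms scale[of c 0] integral_mode[of k] integral_mode[of "- k"] by simp
qed

section \<open>A smooth periodic partition of unity\<close>

text \<open>
  The two translates of the fundamental interval that meet the support are folded into one.
\<close>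

lemma integral_periodize:
  fixes w :: "real \<Rightarrow> complex"
  assumes w: "loc_integrable w" and per: "AE s in lebesgue. w (s + 2 * pi) = w s"
    and \<kappa>: "test_function \<kappa>" "\<And>x. x \<notin> {0..4*pi} \<Longrightarrow> \<kappa> x = 0"
    and sum: "\<And>s. s \<in> {0<..<2*pi} \<Longrightarrow> \<kappa> s + \<kappa> (s + 2 * pi) = c"
  shows "(LINT s|lebesgue. w s * of_real (\<kappa> s)) = of_real c * (LINT s:{0<..<2*pi}|lebesgue. w s)"
proof -
  let ?g = "\<lambda>s. w s * of_real (\<kappa> s)"
  let ?I = "{0<..<2*pi} :: real set" and ?J = "{2*pi<..<4*pi} :: real set"
  have g: "integrable lebesgue ?g"
    by (rule integrable_mult_test[OF w \<kappa>(1)])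
  have gI: "integrable lebesgue (\<lambda>s. indicator ?I s *\<^sub>R ?g s)" and gJ: "integrable lebesgue (\<lambda>s. indicator ?J s *\<^sub>R ?g s)"
    by (rule integrable_mult_indicator[OF _ g]; simp)+
  have shift: "integrable lebesgue (\<lambda>s. indicator ?I s *\<^sub>R ?g (s + 2 * pi))"
    "(LINT s|lebesgue. indicator ?J s *\<^sub>R ?g s) = (LINT s|lebesgue. indicator ?I s *\<^sub>R ?g (s + 2 * pi))"
  proof -
    have ind: "indicator ?J (2 * pi + 1 * s) = (indicator ?I s :: real)" for s
      by (simp add: indicator_def)
    show "(LINT s|lebesgue. indicator ?J s *\<^sub>R ?g s) = (LINT s|lebesgue. indicator ?I s *\<^sub>R ?g (s + 2 * pi))"
      using lebesgue_integral_real_affine[of 1 "\<lambda>s. indicator ?J s *\<^sub>R ?g s" "2 * pi"]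
      unfolding ind by (simp add: add.commute)
    show "integrable lebesgue (\<lambda>s. indicator ?I s *\<^sub>R ?g (s + 2 * pi))"
      using lebesgue_integrable_real_affine[OF gJ, of 1 "2 * pi"] unfolding ind
      by (simp add: add.commute)
  qed
  have "AE s in lebesgue. s \<notin> {0, 2 * pi, 4 * pi}"
    by (rule AE_not_in) (intro null_sets_completionI finite_imp_null_set_lborel, simp)
  then have "AE s in lebesgue. ?g s = indicator ?I s *\<^sub>R ?g s + indicator ?J s *\<^sub>R ?g s"
  proof eventually_elim
    case (elim s)
    then consider "s \<in> ?I" | "s \<in> ?J" | "s \<notin> {0..4*pi}"
      by force
    then show ?case
      by cases (auto simp: \<kappa>(2) indicator_def)
  qed
  then have "(LINT s|lebesgue. ?g s) = (LINT s|lebesgue. indicator ?I s *\<^sub>R ?g s + indicator ?J s *\<^sub>R ?g s)"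
    by (intro integral_cong_AE) (use g gI gJ in auto)
  also have "\<dots> = (LINT s|lebesgue. indicator ?I s *\<^sub>R ?g s) + (LINT s|lebesgue. indicator ?I s *\<^sub>R ?g (s + 2 * pi))"
    using gI gJ shift(2) by simp
  also have "\<dots> = (LINT s|lebesgue. indicator ?I s *\<^sub>R ?g s + indicator ?I s *\<^sub>R ?g (s + 2 * pi))"
    using gI shift(1) by simp
  also have "\<dots> = (LINT s|lebesgue. of_real c * (indicator ?I s *\<^sub>R w s))"
  proof (rule integral_cong_AE)
    show "(\<lambda>s. of_real c * (indicator ?I s *\<^sub>R w s)) \<in> borel_measurable lebesgue"
      using loc_integrable_measurable[OF w]
      by (intro borel_measurable_times borel_measurable_scaleR borel_measurable_indicator) auto
    show "AE s in lebesgue. indicator ?I s *\<^sub>R ?g s + indicator ?I s *\<^sub>R ?g (s + 2 * pi) = of_real c * (indicator ?I s *\<^sub>R w s)"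
      using per
    proof eventually_elim
      case (elim s)
      show ?case
      proof (cases "s \<in> ?I")
        case True
        have "of_real c = complex_of_real (\<kappa> s) + of_real (\<kappa> (s + 2 * pi))"
          using sum[OF True] by (metis of_real_add)
        then show ?thesis using True elim by (simp add: algebra_simps)
      qed simp
    qed
  qed (use gI shift(1) in auto)
  also have "\<dots> = of_real c * (LINT s:?I|lebesgue. w s)"
    unfolding set_lebesgue_integral_def by (rule integral_mult_right_zero)
  finally show ?thesis .
qed

lemma periodic_sum_deriv:
  assumes \<kappa>: "test_function \<kappa>" and sum: "\<And>s. s \<in> {0<..<2*pi} \<Longrightarrow> \<kappa> s + \<kappa> (s + 2 * pi) = c"
    and s: "s \<in> {0<..<2*pi}"
  shows "deriv \<kappa> s + deriv \<kappa> (s + 2 * pi) = 0"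
proof -
  have "((\<lambda>s. \<kappa> (s + 2 * pi)) has_real_derivative deriv \<kappa> (s + 2 * pi)) (at s)"
    using test_function_has_deriv[OF \<kappa>, of "s + 2 * pi"] by (simp add: DERIV_shift)
  from DERIV_add[OF test_function_has_deriv[OF \<kappa>] this]
  have "((\<lambda>s. \<kappa> s + \<kappa> (s + 2 * pi)) has_real_derivative deriv \<kappa> s + deriv \<kappa> (s + 2 * pi)) (at s)" .
  moreover have "((\<lambda>s. \<kappa> s + \<kappa> (s + 2 * pi)) has_real_derivative 0) (at s)"
    by (rule has_field_derivative_transform_within_open[where f = "\<lambda>_. c" and S = "{0<..<2*pi}"])
      (use s sum in auto)
  ultimately show ?thesis by (rule DERIV_unique)
qed

text \<open>
  Pairing with such a \<open>\<phi>\<close> extracts the mean over a period from a weak equation on the whole line, and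
  the terms with derivatives drop out. Take \<open>\<phi> s = H s - H (s - 2 \<pi>)\<close>, where \<open>H\<close> is a smooth step from 0 to 1 across
  the fundamental interval: the sum of the translates telescopes.
\<close>

lemma periodic_partition_of_unity:
  obtains \<phi> where "test_function \<phi>"
    "\<And>w. loc_integrable w \<Longrightarrow> (AE s in lebesgue. w (s + 2 * pi) = w s) \<Longrightarrow>
      (LINT s|lebesgue. w s * of_real (\<phi> s)) = (LINT s:{0<..<2*pi}|lebesgue. w s)"
    "\<And>w. loc_integrable w \<Longrightarrow> (AE s in lebesgue. w (s + 2 * pi) = w s) \<Longrightarrow>
      (LINT s|lebesgue. w s * of_real (deriv \<phi> s)) = 0"
    "\<And>w. loc_integrable w \<Longrightarrow> (AE s in lebesgue. w (s + 2 * pi) = w s) \<Longrightarrow>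
      (LINT s|lebesgue. w s * of_real (deriv (deriv \<phi>) s)) = 0"
proof -
  obtain \<eta> where \<eta>: "test_function \<eta>" "\<And>x. \<eta> x \<ge> 0" "\<And>x. x \<notin> {0<..<2*pi} \<Longrightarrow> \<eta> x = 0"
    "(LINT s|lebesgue. \<eta> s) = 1"
    using standard_bump by metis
  obtain H where H: "\<And>x. (H has_real_derivative \<eta> x) (at x)" "\<And>x. x \<le> 0 \<Longrightarrow> H x = 0"
    "\<And>x. 2 * pi \<le> x \<Longrightarrow> H x = 1"
  proof (rule primitive_of_test_function[OF \<eta>(1,3), of 0 "2 * pi"])
    show "0 \<le> 2 * pi" by simp
  qed (use \<eta>(4) in \<open>auto intro: that\<close>)
  define \<phi> where "\<phi> s = H s - H (s - 2 * pi)" for s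
  have supp: "\<phi> x = 0" if "x \<notin> {0..4*pi}" for x
    using that H(2)[of x] H(2)[of "x - 2 * pi"] H(3)[of x] H(3)[of "x - 2 * pi"] pi_gt_zero
    by (cases "x < 0") (auto simp: \<phi>_def)
  have smooth: "smooth_upto n H" for n
    using smooth_upto_SucI[OF H(1), of n] \<eta>(1) smooth_upto_SucD(3) by (auto simp: test_function_iff)
  have "smooth_upto n (\<lambda>s. H s + (- 1) * H (1 * s + - (2 * pi)))" for n
    by (intro smooth_upto_add smooth_upto_mult smooth_upto_const smooth_upto_affine smooth)
  then have \<phi>: "test_function \<phi>"
    by (intro test_functionI[OF _ supp]) (simp add: \<phi>_def[abs_def])
  have sum: "\<phi> s + \<phi> (s + 2 * pi) = 1" if "s \<in> {0<..<2*pi}" for s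
    using that H(2)[of "s - 2 * pi"] H(3)[of "s + 2 * pi"] by (simp add: \<phi>_def)
  note \<phi>1 = test_function_deriv[OF \<phi>] deriv_eq_0_outside[OF supp] periodic_sum_deriv[OF \<phi> sum]
  note \<phi>2 = test_function_deriv[OF \<phi>1(1)] deriv_eq_0_outside[OF \<phi>1(2)] periodic_sum_deriv[OF \<phi>1(1,3)]
  show thesis
  proof (rule that[OF \<phi>])
    fix w :: "real \<Rightarrow> complex"
    assume w: "loc_integrable w" "AE s in lebesgue. w (s + 2 * pi) = w s"
    show "(LINT s|lebesgue. w s * of_real (\<phi> s)) = (LINT s:{0<..<2*pi}|lebesgue. w s)"
      using integral_periodize[OF w \<phi> supp sum] by simp
    show "(LINT s|lebesgue. w s * of_real (deriv \<phi> s)) = 0"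
      using integral_periodize[OF w \<phi>1] by simp
    show "(LINT s|lebesgue. w s * of_real (deriv (deriv \<phi>) s)) = 0"
      using integral_periodize[OF w \<phi>2] by simp
  qed
qed

section \<open>The weak form of the equation and its derivatives in the forcing\<close>

text \<open>
  The formal transpose of the linear part \<open>- d w'' + i \<omega> w' + c w\<close>. It moves all derivatives to the test
  function, so that the weak equation involves only \<open>w\<close>.
\<close>

definition dual_op :: "real \<Rightarrow> real \<Rightarrow> complex \<Rightarrow> (real \<Rightarrow> real) \<Rightarrow> real \<Rightarrow> complex" where
  "dual_op d \<omega> c \<phi> s = - of_real d * of_real (deriv (deriv \<phi>) s)
     - \<i> * of_real \<omega> * of_real (deriv \<phi> s) + c * of_real (\<phi> s)"

lemma integrable_dual_op:
  assumes w: "loc_integrable w" and \<phi>: "test_function \<phi>"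
  shows "integrable lebesgue (\<lambda>s. w s * dual_op d \<omega> c \<phi> s)"
    and "(LINT s|lebesgue. w s * dual_op d \<omega> c \<phi> s) =
      - of_real d * (LINT s|lebesgue. w s * of_real (deriv (deriv \<phi>) s))
      - \<i> * of_real \<omega> * (LINT s|lebesgue. w s * of_real (deriv \<phi> s))
      + c * (LINT s|lebesgue. w s * of_real (\<phi> s))"
proof -
  note int = integrable_mult_test[OF w test_function_deriv[OF test_function_deriv[OF \<phi>]]]
    integrable_mult_test[OF w test_function_deriv[OF \<phi>]] integrable_mult_test[OF w \<phi>]
  have eq: "(\<lambda>s. w s * dual_op d \<omega> c \<phi> s) =
      (\<lambda>s. - of_real d * (w s * of_real (deriv (deriv \<phi>) s))
        - \<i> * of_real \<omega> * (w s * of_real (deriv \<phi> s)) + c * (w s * of_real (\<phi> s)))"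
    by (auto simp: dual_op_def algebra_simps)
  have "has_bochner_integral lebesgue (\<lambda>s. w s * dual_op d \<omega> c \<phi> s)
     (- of_real d * (LINT s|lebesgue. w s * of_real (deriv (deriv \<phi>) s))
      - \<i> * of_real \<omega> * (LINT s|lebesgue. w s * of_real (deriv \<phi> s))
      + c * (LINT s|lebesgue. w s * of_real (\<phi> s)))"
    unfolding eq
    by (intro has_bochner_integral_add has_bochner_integral_diff has_bochner_integral_mult_right
        has_bochner_integral_integrable int)
  then show "integrable lebesgue (\<lambda>s. w s * dual_op d \<omega> c \<phi> s)"
    and "(LINT s|lebesgue. w s * dual_op d \<omega> c \<phi> s) =
      - of_real d * (LINT s|lebesgue. w s * of_real (deriv (deriv \<phi>) s))
      - \<i> * of_real \<omega> * (LINT s|lebesgue. w s * of_real (deriv \<phi> s))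
      + c * (LINT s|lebesgue. w s * of_real (\<phi> s))"
    by (auto simp: has_bochner_integral_iff)
qed

lemma test_second_order_op:
  assumes w: "w \<in> H2per" and \<phi>: "test_function \<phi>"
  shows "(LINT s|lebesgue. (- of_real d * weak_deriv 2 w s + \<i> * of_real \<omega> * weak_deriv 1 w s + c * w s) * of_real (\<phi> s)) =
    (LINT s|lebesgue. w s * dual_op d \<omega> c \<phi> s)"
proof -
  note p2 = weak_deriv_props[OF w order_refl] and p1 = weak_deriv_props[OF w one_le_numeral]
  note int = integrable_mult_test[OF loc_square_integrable_imp_loc_integrable[OF p2(1)] \<phi>]
    integrable_mult_test[OF loc_square_integrable_imp_loc_integrable[OF p1(1)] \<phi>]
    integrable_mult_test[OF H2per_loc_integrable[OF w] \<phi>]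
  have "(LINT s|lebesgue. (- of_real d * weak_deriv 2 w s + \<i> * of_real \<omega> * weak_deriv 1 w s + c * w s) * of_real (\<phi> s)) =
      (LINT s|lebesgue. - of_real d * (weak_deriv 2 w s * of_real (\<phi> s))
        + \<i> * of_real \<omega> * (weak_deriv 1 w s * of_real (\<phi> s)) + c * (w s * of_real (\<phi> s)))"
    by (simp add: ring_distribs mult.assoc)
  also have "\<dots> = - of_real d * (LINT s|lebesgue. weak_deriv 2 w s * of_real (\<phi> s))
      + \<i> * of_real \<omega> * (LINT s|lebesgue. weak_deriv 1 w s * of_real (\<phi> s))
      + c * (LINT s|lebesgue. w s * of_real (\<phi> s))"
    by (intro has_bochner_integral_integral_eq has_bochner_integral_add has_bochner_integral_mult_right
        has_bochner_integral_integrable int)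
  also have "(LINT s|lebesgue. weak_deriv 2 w s * of_real (\<phi> s)) =
      (LINT s|lebesgue. w s * of_real (deriv (deriv \<phi>) s))"
    using p2(2) \<phi> by (simp add: has_weak_deriv_def eval_nat_numeral)
  also have "(LINT s|lebesgue. weak_deriv 1 w s * of_real (\<phi> s)) =
      - (LINT s|lebesgue. w s * of_real (deriv \<phi> s))"
    using p1(2) \<phi> by (simp add: has_weak_deriv_def)
  finally show ?thesis
    by (simp add: integrable_dual_op(2)[OF H2per_loc_integrable[OF w] \<phi>])
qed

lemma lle_solution_weak:
  assumes sol: "lle_solution d \<zeta> \<omega> f0 k1 f1 u" and \<phi>: "test_function \<phi>"
  shows "(LINT s|lebesgue. u s * dual_op d \<omega> (of_real \<zeta> - \<i>) \<phi> s)
    - (LINT s|lebesgue. (u s * u s * cnj (u s)) * of_real (\<phi> s))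
    + \<i> * of_real f0 * (LINT s|lebesgue. of_real (\<phi> s))
    + \<i> * of_real f1 * (LINT s|lebesgue. mode (int k1) s * of_real (\<phi> s)) = 0"
proof -
  have u: "u \<in> H2per" using sol by (simp add: lle_solution_def)
  note p2 = weak_deriv_props[OF u order_refl] and p1 = weak_deriv_props[OF u one_le_numeral]
  let ?L = "\<lambda>s. - of_real d * weak_deriv 2 u s + \<i> * of_real \<omega> * weak_deriv 1 u s + (of_real \<zeta> - \<i>) * u s"
  let ?N = "\<lambda>s. u s * u s * cnj (u s)"
  have L: "loc_integrable ?L"
    by (intro loc_integrable_add loc_integrable_cmult H2per_loc_integrable u
        loc_square_integrable_imp_loc_integrable p1 p2)
  have N: "loc_integrable ?N"
    by (intro ess_bounded_imp_loc_integrable ess_bounded_mult ess_bounded_cnj H2per_ess_bounded u)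
  have one: "loc_integrable (\<lambda>s. 1)" and E: "loc_integrable (mode (int k1))"
    by (intro ess_bounded_imp_loc_integrable ess_bounded_const ess_bounded_mode)+
  have oneint: "integrable lebesgue (\<lambda>s. complex_of_real (\<phi> s))"
    using integrable_mult_test[OF one \<phi>] by simp
  have "AE s in lebesgue. ?L s * of_real (\<phi> s) - ?N s * of_real (\<phi> s)
      + \<i> * of_real f0 * of_real (\<phi> s) + \<i> * of_real f1 * (mode (int k1) s * of_real (\<phi> s)) = 0"
    using sol[unfolded lle_solution_def, THEN conjunct2]
  proof eventually_elim
    case (elim s)
    have N_eq: "?N s = of_real ((cmod (u s))\<^sup>2) * u s"
      unfolding complex_norm_square by (simp only: mult_ac)
    have "?L s - ?N s + \<i> * of_real f0 + \<i> * of_real f1 * mode (int k1) s = 0"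
      unfolding N_eq mode_def of_int_of_nat_eq by (rule elim)
    from arg_cong[OF this, of "\<lambda>t. t * of_real (\<phi> s)"] show ?case
      by (simp add: algebra_simps)
  qed
  then have "(LINT s|lebesgue. ?L s * of_real (\<phi> s) - ?N s * of_real (\<phi> s)
      + \<i> * of_real f0 * of_real (\<phi> s) + \<i> * of_real f1 * (mode (int k1) s * of_real (\<phi> s))) = 0"
    by (rule integral_eq_zero_AE)
  moreover have "(LINT s|lebesgue. ?L s * of_real (\<phi> s) - ?N s * of_real (\<phi> s)
      + \<i> * of_real f0 * of_real (\<phi> s) + \<i> * of_real f1 * (mode (int k1) s * of_real (\<phi> s))) =
      (LINT s|lebesgue. ?L s * of_real (\<phi> s)) - (LINT s|lebesgue. ?N s * of_real (\<phi> s))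
    + \<i> * of_real f0 * (LINT s|lebesgue. of_real (\<phi> s))
    + \<i> * of_real f1 * (LINT s|lebesgue. mode (int k1) s * of_real (\<phi> s))"
    by (intro has_bochner_integral_integral_eq has_bochner_integral_add has_bochner_integral_diff
        has_bochner_integral_mult_right has_bochner_integral_integrable
        integrable_mult_test[OF L \<phi>] integrable_mult_test[OF N \<phi>] integrable_mult_test[OF E \<phi>] oneint)
  ultimately show ?thesis
    by (simp only: test_second_order_op[OF u \<phi>])
qed

lemma lin_op_eq_of_weak:
  assumes w: "w \<in> H2per" and g: "loc_integrable g"
    and weak: "\<And>\<phi>. test_function \<phi> \<Longrightarrow>
      (LINT s|lebesgue. w s * dual_op d \<omega> (of_real \<zeta> - \<i> - 2 * of_real ((cmod u0)\<^sup>2)) \<phi> s)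
      - u0\<^sup>2 * (LINT s|lebesgue. cnj (w s) * of_real (\<phi> s)) = (LINT s|lebesgue. g s * of_real (\<phi> s))"
  shows "AE s in lebesgue. lin_op d \<zeta> \<omega> u0 w s = g s"
proof -
  note p2 = weak_deriv_props[OF w order_refl] and p1 = weak_deriv_props[OF w one_le_numeral]
  let ?L = "\<lambda>s. - of_real d * weak_deriv 2 w s + \<i> * of_real \<omega> * weak_deriv 1 w s
    + (of_real \<zeta> - \<i> - 2 * of_real ((cmod u0)\<^sup>2)) * w s"
  have L: "loc_integrable ?L"
    by (intro loc_integrable_add loc_integrable_cmult H2per_loc_integrable w
        loc_square_integrable_imp_loc_integrable p1 p2)
  have c: "loc_integrable (\<lambda>s. cnj (w s))"
    by (intro loc_integrable_cnj H2per_loc_integrable w)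
  have "AE s in lebesgue. ?L s + (- (u0\<^sup>2)) * cnj (w s) + (- 1) * g s = 0"
  proof (rule fundamental_lemma)
    show "loc_integrable (\<lambda>s. ?L s + (- (u0\<^sup>2)) * cnj (w s) + (- 1) * g s)"
      by (rule loc_integrable_add[OF loc_integrable_add[OF L loc_integrable_cmult[OF c]] loc_integrable_cmult[OF g]])
    fix \<phi> assume \<phi>: "test_function \<phi>"
    have "(LINT s|lebesgue. (?L s + (- (u0\<^sup>2)) * cnj (w s) + (- 1) * g s) * of_real (\<phi> s)) =
      (LINT s|lebesgue. ?L s * of_real (\<phi> s) - u0\<^sup>2 * (cnj (w s) * of_real (\<phi> s)) - g s * of_real (\<phi> s))"
      by (rule Bochner_Integration.integral_cong) (auto simp: algebra_simps)
    also have "\<dots> = (LINT s|lebesgue. ?L s * of_real (\<phi> s)) - u0\<^sup>2 * (LINT s|lebesgue. cnj (w s) * of_real (\<phi> s))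
        - (LINT s|lebesgue. g s * of_real (\<phi> s))"
      by (intro has_bochner_integral_integral_eq has_bochner_integral_diff
        has_bochner_integral_mult_right has_bochner_integral_integrable
        integrable_mult_test[OF L \<phi>] integrable_mult_test[OF c \<phi>] integrable_mult_test[OF g \<phi>])
    also have "\<dots> = 0"
      using weak[OF \<phi>] by (simp only: test_second_order_op[OF w \<phi>] right_minus_eq)
    finally show "(LINT s|lebesgue. (?L s + (- (u0\<^sup>2)) * cnj (w s) + (- 1) * g s) * of_real (\<phi> s)) = 0" .
  qed
  then show ?thesis
    by eventually_elim (simp add: lin_op_def)
qed

text \<open>
  For a fixed test function the weak equation says that a certain number \<open>E f\<close>, built from integrals of
  products, vanishes for all small \<open>f\<close>. Hence its first and second derivatives vanish, and these are the weak forms of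
  the first and second variation of the equation at the constant state.
\<close>

lemma lle_curve_derivatives:
  assumes "\<delta> > 0"
    and solution: "\<forall>f\<in>{-\<delta><..<\<delta>}. lle_solution d \<zeta> \<omega> f0 k1 f (U f)"
    and derivative: "\<forall>f\<in>{-\<delta><..<\<delta>}. has_ess_derivative U (V f) f"
    and V: "has_ess_derivative V W 0"
    and U0: "AE s in lebesgue. U 0 s = u0"
    and \<phi>: "test_function \<phi>"
  shows "(LINT s|lebesgue. V 0 s * dual_op d \<omega> (of_real \<zeta> - \<i>) \<phi> s)
      - (LINT s|lebesgue. (2 * of_real ((cmod u0)\<^sup>2) * V 0 s + u0\<^sup>2 * cnj (V 0 s)) * of_real (\<phi> s))
      + \<i> * (LINT s|lebesgue. mode (int k1) s * of_real (\<phi> s)) = 0"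
    and "(LINT s|lebesgue. W s * dual_op d \<omega> (of_real \<zeta> - \<i>) \<phi> s)
      - (LINT s|lebesgue. (2 * of_real ((cmod u0)\<^sup>2) * W s + u0\<^sup>2 * cnj (W s)
          + 4 * u0 * (V 0 s * cnj (V 0 s)) + 2 * cnj u0 * (V 0 s * V 0 s)) * of_real (\<phi> s)) = 0"
proof -
  note sol = bspec[OF solution] and U = bspec[OF derivative]
  let ?g = "dual_op d \<omega> (of_real \<zeta> - \<i>) \<phi>" and ?p = "\<lambda>s. complex_of_real (\<phi> s)"
  let ?I = "{-\<delta><..<\<delta>}"
  have one: "loc_integrable (\<lambda>s. 1)"
    by (intro ess_bounded_imp_loc_integrable ess_bounded_const)
  have g: "integrable lebesgue ?g" and p: "integrable lebesgue ?p"
    using integrable_dual_op(1)[OF one \<phi>] integrable_mult_test[OF one \<phi>] by simp_all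
  have I0: "0 \<in> ?I" using \<open>\<delta> > 0\<close> by simp
  define c0 where "c0 = \<i> * of_real f0 * (LINT s|lebesgue. ?p s)"
  define c1 where "c1 = \<i> * (LINT s|lebesgue. mode (int k1) s * ?p s)"
  define cub where "cub f = (\<lambda>s. U f s * U f s * cnj (U f s))" for f
  define cub1 where "cub1 f = (\<lambda>s. (V f s * U f s + U f s * V f s) * cnj (U f s) + U f s * U f s * cnj (V f s))" for f
  define cub2 where "cub2 = (\<lambda>s. ((W s * U 0 s + V 0 s * V 0 s) + (V 0 s * V 0 s + U 0 s * W s)) * cnj (U 0 s)
     + (V 0 s * U 0 s + U 0 s * V 0 s) * cnj (V 0 s)
     + ((V 0 s * U 0 s + U 0 s * V 0 s) * cnj (V 0 s) + U 0 s * U 0 s * cnj (W s)))"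
  have cub: "has_ess_derivative cub (cub1 f) f" if "f \<in> ?I" for f
    unfolding cub_def[abs_def] cub1_def
    by (intro has_ess_derivative_mult has_ess_derivative_cnj U that)
  have cub1: "has_ess_derivative cub1 cub2 0"
    unfolding cub1_def[abs_def] cub2_def
    by (intro has_ess_derivative_add has_ess_derivative_mult has_ess_derivative_cnj V U[OF I0])
  define E where "E f = (LINT s|lebesgue. U f s * ?g s) - (LINT s|lebesgue. cub f s * ?p s) + c0 + f *\<^sub>R c1" for f
  define E1 where "E1 f = (LINT s|lebesgue. V f s * ?g s) - (LINT s|lebesgue. cub1 f s * ?p s) + c1" for f
  define E2 where "E2 = (LINT s|lebesgue. W s * ?g s) - (LINT s|lebesgue. cub2 s * ?p s)"
  have E0: "E f = 0" if "f \<in> ?I" for f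
    using lle_solution_weak[OF sol[OF that] \<phi>]
    unfolding E_def cub_def c0_def c1_def scaleR_conv_of_real
    by (simp only: mult.assoc mult.left_commute[of "complex_of_real f"])
  have "(E has_vector_derivative E1 f) (at f)" if "f \<in> ?I" for f
    unfolding E_def[abs_def] E1_def
    by (rule derivative_eq_intros has_ess_derivative_integral[OF U[OF that] g]
        has_ess_derivative_integral[OF cub[OF that] p] refl)+ simp
  moreover have "(E has_vector_derivative 0) (at f)" if "f \<in> ?I" for f
    by (rule has_vector_derivative_transform_within_open[where f = "\<lambda>_. 0" and S = ?I])
      (use that E0 in auto)
  \<comment> \<open>A curve of numbers that vanishes on an interval has derivative 0 there.\<close>
  ultimately have E1: "E1 f = 0" if "f \<in> ?I" for f
    using that vector_derivative_unique_at by blast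
  have "(E1 has_vector_derivative E2) (at 0)"
    unfolding E1_def[abs_def] E2_def
    by (rule derivative_eq_intros has_ess_derivative_integral[OF V g]
        has_ess_derivative_integral[OF cub1 p] refl)+ simp
  moreover have "(E1 has_vector_derivative 0) (at 0)"
    by (rule has_vector_derivative_transform_within_open[where f = "\<lambda>_. 0" and S = ?I])
      (use I0 E1 in auto)
  ultimately have E2: "E2 = 0"
    using vector_derivative_unique_at by blast
  have bd: "ess_bounded (U 0)" "ess_bounded (V 0)" "ess_bounded W"
    using U[OF I0] V by (auto simp: has_ess_derivative_def)
  have b1: "ess_bounded (cub1 0)" "ess_bounded cub2"
    using cub[OF I0] cub1 by (auto simp: has_ess_derivative_def)
  have "(LINT s|lebesgue. cub1 0 s * ?p s) =
      (LINT s|lebesgue. (2 * of_real ((cmod u0)\<^sup>2) * V 0 s + u0\<^sup>2 * cnj (V 0 s)) * ?p s)"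
  proof (rule integral_cong_AE)
    show "AE s in lebesgue. cub1 0 s * ?p s = (2 * of_real ((cmod u0)\<^sup>2) * V 0 s + u0\<^sup>2 * cnj (V 0 s)) * ?p s"
      unfolding complex_norm_square using U0
      by eventually_elim (simp add: cub1_def power2_eq_square algebra_simps)
    show "(\<lambda>s. cub1 0 s * ?p s) \<in> borel_measurable lebesgue"
      using ess_bounded_integrable_mult[OF b1(1) p] by simp
    have "integrable lebesgue (\<lambda>s. (2 * of_real ((cmod u0)\<^sup>2) * V 0 s + u0\<^sup>2 * cnj (V 0 s)) * ?p s)"
      by (intro ess_bounded_integrable_mult p ess_bounded_add ess_bounded_mult ess_bounded_const ess_bounded_cnj bd)
    then show "(\<lambda>s. (2 * of_real ((cmod u0)\<^sup>2) * V 0 s + u0\<^sup>2 * cnj (V 0 s)) * ?p s) \<in> borel_measurable lebesgue"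
      by simp
  qed
  then show "(LINT s|lebesgue. V 0 s * ?g s)
      - (LINT s|lebesgue. (2 * of_real ((cmod u0)\<^sup>2) * V 0 s + u0\<^sup>2 * cnj (V 0 s)) * ?p s)
      + \<i> * (LINT s|lebesgue. mode (int k1) s * ?p s) = 0"
    using E1[OF I0] by (simp only: E1_def c1_def)
  let ?Q = "\<lambda>s. 2 * of_real ((cmod u0)\<^sup>2) * W s + u0\<^sup>2 * cnj (W s)
          + 4 * u0 * (V 0 s * cnj (V 0 s)) + 2 * cnj u0 * (V 0 s * V 0 s)"
  have "(LINT s|lebesgue. cub2 s * ?p s) = (LINT s|lebesgue. ?Q s * ?p s)"
  proof (rule integral_cong_AE)
    show "AE s in lebesgue. cub2 s * ?p s = ?Q s * ?p s"
      unfolding complex_norm_square using U0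
      by eventually_elim (simp add: cub2_def power2_eq_square algebra_simps)
    show "(\<lambda>s. cub2 s * ?p s) \<in> borel_measurable lebesgue"
      using ess_bounded_integrable_mult[OF b1(2) p] by simp
    have "integrable lebesgue (\<lambda>s. ?Q s * ?p s)"
      by (intro ess_bounded_integrable_mult p ess_bounded_add ess_bounded_mult ess_bounded_const ess_bounded_cnj bd)
    then show "(\<lambda>s. ?Q s * ?p s) \<in> borel_measurable lebesgue"
      by simp
  qed
  then show "(LINT s|lebesgue. W s * ?g s) - (LINT s|lebesgue. ?Q s * ?p s) = 0"
    using E2 by (simp only: E2_def)
qed

section \<open>Non-degeneracy and the linearised equations\<close>

lemma two_modes_norm_square:
  "(a * mode k s + b * mode (- k) s) * cnj (a * mode k s + b * mode (- k) s) =
    of_real ((cmod a)\<^sup>2 + (cmod b)\<^sup>2) + a * cnj b * mode (2 * k) s + b * cnj a * mode (- (2 * k)) s"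
proof -
  have 1: "mode k s * mode (- k) s = 1" "mode (- k) s * mode k s = 1"
    by (simp_all add: mode_add[symmetric])
  have 2: "mode (2 * k) s = mode k s * mode k s" "mode (- (2 * k)) s = mode (- k) s * mode (- k) s"
    by (simp_all add: mode_add[symmetric])
  show ?thesis
    unfolding 2 of_real_add complex_norm_square complex_cnj_add complex_cnj_mult cnj_mode minus_minus
    using 1 by algebra
qed

lemma two_modes_square:
  "(a * mode k s + b * mode (- k) s) * (a * mode k s + b * mode (- k) s) =
    2 * a * b + a\<^sup>2 * mode (2 * k) s + b\<^sup>2 * mode (- (2 * k)) s"
proof -
  have 1: "mode k s * mode (- k) s = 1"
    by (simp add: mode_add[symmetric])
  have 2: "mode (2 * k) s = mode k s * mode k s" "mode (- (2 * k)) s = mode (- k) s * mode (- k) s"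
    by (simp_all add: mode_add[symmetric])
  show ?thesis
    unfolding 2 using 1 by algebra
qed

lemma set_integral_cong_AE_UNIV:
  fixes f g :: "real \<Rightarrow> complex"
  assumes "AE s in lebesgue. f s = g s" "f \<in> borel_measurable lebesgue" "g \<in> borel_measurable lebesgue"
  shows "(LINT s:{a<..<b}|lebesgue. f s) = (LINT s:{a<..<b}|lebesgue. g s)"
  unfolding set_lebesgue_integral_def
proof (rule integral_cong_AE)
  show "AE s in lebesgue. indicat_real {a<..<b} s *\<^sub>R f s = indicat_real {a<..<b} s *\<^sub>R g s"
    using assms(1) by eventually_elim simp
qed (auto intro!: borel_measurable_scaleR borel_measurable_indicator assms)

text \<open>
  The zero function is written as a combination of modes so that its image under the operator can be
  computed.
\<close>

lemma non_degenerate_kernel: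
  assumes "non_degenerate d \<zeta> \<omega> u0" "w \<in> H2per" "AE s in lebesgue. lin_op d \<zeta> \<omega> u0 w s = 0"
  shows "AE s in lebesgue. w s = 0"
proof -
  have "AE s in lebesgue. lin_op d \<zeta> \<omega> u0 w s = lin_op d \<zeta> \<omega> u0 (\<lambda>s. 0 * mode 0 s + 0 * mode (- 0) s) s"
    using assms(3) lin_op_two_modes[of d \<zeta> \<omega> u0 0 0 0]
    by eventually_elim simp
  then have "AE s in lebesgue. w s = 0 * mode 0 s + 0 * mode (- 0) s"
    using assms(1,2) H2per_lincomb[OF mode_H2per mode_H2per] unfolding non_degenerate_def by blast
  then show ?thesis by simp
qed

lemma non_degenerate_two_modes:
  assumes nd: "non_degenerate d \<zeta> \<omega> u0" and k: "k \<noteq> 0"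
    and a: "(of_real d * of_int k ^ 2 - of_real \<omega> * of_int k + (of_real \<zeta> - \<i> - 2 * of_real ((cmod u0)\<^sup>2))) * a
       = u0\<^sup>2 * cnj b"
    and b: "(of_real d * of_int k ^ 2 + of_real \<omega> * of_int k + (of_real \<zeta> - \<i> - 2 * of_real ((cmod u0)\<^sup>2))) * b
       = u0\<^sup>2 * cnj a"
  shows "a = 0"
proof -
  have "AE s in lebesgue. lin_op d \<zeta> \<omega> u0 (\<lambda>s. a * mode k s + b * mode (- k) s) s = 0"
    using lin_op_two_modes[of d \<zeta> \<omega> u0 a k b]
    by eventually_elim (simp only: a b diff_self mult_zero_left add_0)
  then have "AE s in lebesgue. a * mode k s + b * mode (- k) s = 0"
    by (rule non_degenerate_kernel[OF nd H2per_lincomb[OF mode_H2per mode_H2per]])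
  then have "AE s in lebesgue. of_real ((cmod a)\<^sup>2 + (cmod b)\<^sup>2) + a * cnj b * mode (2 * k) s
      + b * cnj a * mode (- (2 * k)) s = 0"
    unfolding two_modes_norm_square[symmetric] by eventually_elim simp
  then have "(LINT s:{0<..<2*pi}|lebesgue. of_real ((cmod a)\<^sup>2 + (cmod b)\<^sup>2) + a * cnj b * mode (2 * k) s
      + b * cnj a * mode (- (2 * k)) s) = (LINT s:{0<..<2*pi}|lebesgue. 0)"
    by (rule set_integral_cong_AE_UNIV)
      (auto intro!: borel_measurable_times borel_measurable_add mode_measurable)
  then have "complex_of_real ((cmod a)\<^sup>2 + (cmod b)\<^sup>2) = 0"
    using k by (subst (asm) set_integral_two_modes) (simp_all del: of_real_add of_real_power)
  then show "a = 0"
    by (simp only: of_real_eq_0_iff sum_power2_eq_zero_iff norm_eq_zero)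
qed

lemma non_degenerate_constants:
  assumes nd: "non_degenerate d \<zeta> \<omega> u0"
    and c: "(of_real \<zeta> - \<i> - 2 * of_real ((cmod u0)\<^sup>2)) * c = u0\<^sup>2 * cnj c"
  shows "c = 0"
proof -
  have "AE s in lebesgue. lin_op d \<zeta> \<omega> u0 (\<lambda>s. c * mode 0 s + 0 * mode (- 0) s) s = 0"
    using lin_op_two_modes[of d \<zeta> \<omega> u0 c 0 0] by eventually_elim (use c in simp)
  then have "AE s in lebesgue. c * mode 0 s + 0 * mode (- 0) s = 0"
    by (rule non_degenerate_kernel[OF nd H2per_lincomb[OF mode_H2per mode_H2per]])
  then have "(LINT s:{0<..<2*pi}|lebesgue. c) = (LINT s:{0<..<2*pi}|lebesgue. 0)"
    by (intro set_integral_cong_AE_UNIV) auto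
  then show "c = 0"
    using set_integral_two_modes[of 1 c 0 0] by simp
qed

lemma of_real_cmod_power4: "of_real (cmod c ^ 4) = c\<^sup>2 * cnj (c\<^sup>2)"
proof -
  have "of_real (cmod c ^ 4) = (complex_of_real ((cmod c)\<^sup>2))\<^sup>2"
    by (simp flip: of_real_power)
  then show ?thesis
    unfolding complex_norm_square by (simp add: power2_eq_square mult_ac)
qed

text \<open>
  If the determinant vanishes, then \<open>(a, b) = (cnj Q, u0\<^sup>2)\<close> solves the homogeneous system for the two
  amplitudes. It is not zero because \<open>Q\<close> has imaginary part \<open>- 1\<close>, which contradicts non-degeneracy.
\<close>

lemma non_degenerate_determinant:
  assumes nd: "non_degenerate d \<zeta> \<omega> u0" and k: "k \<noteq> 0"
    and P: "P = of_real d * of_int k ^ 2 - of_real \<omega> * of_int k + (of_real \<zeta> - \<i> - 2 * of_real ((cmod u0)\<^sup>2))"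
    and Q: "Q = of_real d * of_int k ^ 2 + of_real \<omega> * of_int k + (of_real \<zeta> - \<i> - 2 * of_real ((cmod u0)\<^sup>2))"
  shows "P * cnj Q - of_real (cmod u0 ^ 4) \<noteq> 0"
proof
  assume D: "P * cnj Q - of_real (cmod u0 ^ 4) = 0"
  have "cnj Q = 0"
  \<comment> \<open>The first equation is the vanishing of the determinant; the second is an identity.\<close>
  proof (rule non_degenerate_two_modes[OF nd k, of "cnj Q" "u0\<^sup>2"])
    show "(of_real d * of_int k ^ 2 - of_real \<omega> * of_int k + (of_real \<zeta> - \<i> - 2 * of_real ((cmod u0)\<^sup>2))) * cnj Q
       = u0\<^sup>2 * cnj (u0\<^sup>2)"
      using D unfolding of_real_cmod_power4 P[symmetric] by simp
    show "(of_real d * of_int k ^ 2 + of_real \<omega> * of_int k + (of_real \<zeta> - \<i> - 2 * of_real ((cmod u0)\<^sup>2))) * u0\<^sup>2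
       = u0\<^sup>2 * cnj (cnj Q)"
      unfolding Q[symmetric] by (simp add: mult.commute)
  qed
  moreover have "Im Q = - 1"
    by (simp add: Q power2_eq_square)
  ultimately show False by (metis complex_cnj_zero_iff neg_0_equal_iff_equal zero_complex.sel(2) zero_neq_one)
qed

text \<open>
  If the determinant of the real-linear map \<open>c \<mapsto> x c + y cnj c\<close> vanishes, then \<open>cnj x - y\<close> and
  \<open>i (cnj x + y)\<close> lie in its kernel. Constants in the kernel vanish by non-degeneracy, so \<open>x = 0\<close>, which is
  impossible because the imaginary part of \<open>x\<close> is \<open>- 1\<close>.
\<close>

lemma non_degenerate_mean:
  assumes nd: "non_degenerate d \<zeta> \<omega> u0"
    and x: "x = of_real \<zeta> - \<i> - 2 * of_real ((cmod u0)\<^sup>2)" and y: "y = - (u0\<^sup>2)"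
  shows "(cmod x)\<^sup>2 - (cmod y)\<^sup>2 \<noteq> 0"
proof
  assume "(cmod x)\<^sup>2 - (cmod y)\<^sup>2 = 0"
  then have "complex_of_real ((cmod x)\<^sup>2) = of_real ((cmod y)\<^sup>2)"
    by simp
  then have xy: "x * cnj x = y * cnj y"
    unfolding complex_norm_square .
  have kernel: "c = 0" if "x * c + y * cnj c = 0" for c
    using that by (intro non_degenerate_constants[OF nd]) (simp add: x y)
  have "cnj x - y = 0"
    by (rule kernel) (use xy in \<open>simp add: algebra_simps\<close>)
  moreover have "\<i> * (cnj x + y) = 0"
    by (rule kernel) (use xy in \<open>simp add: algebra_simps\<close>)
  ultimately have "x = 0"
    by (simp add: complex_eq_iff)
  moreover have "Im x = - 1" by (simp add: x)
  ultimately show False by simp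
qed

lemma first_order_amplitudes:
  assumes D: "P * cnj Q - of_real (cmod u0 ^ 4) \<noteq> 0"
    and \<alpha>: "\<alpha> = - \<i> * cnj Q / (P * cnj Q - of_real (cmod u0 ^ 4))"
    and \<beta>: "\<beta> = \<i> * u0\<^sup>2 / cnj (P * cnj Q - of_real (cmod u0 ^ 4))"
  shows "P * \<alpha> - u0\<^sup>2 * cnj \<beta> = - \<i>" "Q * \<beta> - u0\<^sup>2 * cnj \<alpha> = 0"
proof -
  define E where "E = P * cnj Q - of_real (cmod u0 ^ 4)"
  have E: "E \<noteq> 0" "E = P * cnj Q - u0\<^sup>2 * cnj (u0\<^sup>2)"
    using D unfolding E_def of_real_cmod_power4 by simp_all
  have \<alpha>E: "\<alpha> = - \<i> * cnj Q / E" and \<beta>E: "\<beta> = \<i> * u0\<^sup>2 / cnj E"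
    using \<alpha> \<beta> by (simp_all only: E_def)
  then have "P * \<alpha> - u0\<^sup>2 * cnj \<beta> = - \<i> * (P * cnj Q - u0\<^sup>2 * cnj (u0\<^sup>2)) / E"
    by (simp add: diff_divide_distrib[symmetric] algebra_simps)
  then show "P * \<alpha> - u0\<^sup>2 * cnj \<beta> = - \<i>"
    using E by simp
  show "Q * \<beta> - u0\<^sup>2 * cnj \<alpha> = 0"
    using \<alpha>E \<beta>E by simp
qed

text \<open>
  The equation and its conjugate form a two by two linear system for \<open>m\<close> and \<open>cnj m\<close>; this is Cramer's
  rule.
\<close>

lemma solve_conjugate_linear:
  assumes "(cmod x)\<^sup>2 - (cmod y)\<^sup>2 \<noteq> 0" "x * m + y * cnj m = r"
  shows "m = (- cnj r * y + r * cnj x) / of_real ((cmod x)\<^sup>2 - (cmod y)\<^sup>2)"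
proof -
  have "of_real ((cmod x)\<^sup>2 - (cmod y)\<^sup>2) * m = - cnj r * y + r * cnj x"
    unfolding assms(2)[symmetric] of_real_diff complex_norm_square by (simp add: algebra_simps)
  moreover have "complex_of_real ((cmod x)\<^sup>2 - (cmod y)\<^sup>2) \<noteq> 0"
    using assms(1) by (simp only: of_real_eq_0_iff not_False_eq_True)
  ultimately show ?thesis
    by (metis nonzero_mult_div_cancel_left)
qed

section \<open>The norm along the solution curve\<close>

lemma first_variation_lin_op:
  assumes V: "V \<in> H2per"
    and weak: "\<And>\<phi>. test_function \<phi> \<Longrightarrow> (LINT s|lebesgue. V s * dual_op d \<omega> (of_real \<zeta> - \<i>) \<phi> s)
      - (LINT s|lebesgue. (2 * of_real ((cmod u0)\<^sup>2) * V s + u0\<^sup>2 * cnj (V s)) * of_real (\<phi> s))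
      + \<i> * (LINT s|lebesgue. mode k s * of_real (\<phi> s)) = 0"
  shows "AE s in lebesgue. lin_op d \<zeta> \<omega> u0 V s = - \<i> * mode k s"
proof (rule lin_op_eq_of_weak[OF V])
  show "loc_integrable (\<lambda>s. - \<i> * mode k s)"
    by (intro loc_integrable_cmult ess_bounded_imp_loc_integrable ess_bounded_mode)
  fix \<phi> assume \<phi>: "test_function \<phi>"
  note Vi = H2per_loc_integrable[OF V]
  have "(LINT s|lebesgue. (2 * of_real ((cmod u0)\<^sup>2) * V s + u0\<^sup>2 * cnj (V s)) * of_real (\<phi> s)) =
      (LINT s|lebesgue. 2 * of_real ((cmod u0)\<^sup>2) * (V s * of_real (\<phi> s)) + u0\<^sup>2 * (cnj (V s) * of_real (\<phi> s)))"
    by (simp add: distrib_right mult.assoc)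
  also have "\<dots> = 2 * of_real ((cmod u0)\<^sup>2) * (LINT s|lebesgue. V s * of_real (\<phi> s))
      + u0\<^sup>2 * (LINT s|lebesgue. cnj (V s) * of_real (\<phi> s))"
    by (intro has_bochner_integral_integral_eq has_bochner_integral_add
        has_bochner_integral_mult_right has_bochner_integral_integrable
        integrable_mult_test[OF Vi \<phi>] integrable_mult_test[OF loc_integrable_cnj[OF Vi] \<phi>])
  finally have split: "(LINT s|lebesgue. (2 * of_real ((cmod u0)\<^sup>2) * V s + u0\<^sup>2 * cnj (V s)) * of_real (\<phi> s)) =
      2 * of_real ((cmod u0)\<^sup>2) * (LINT s|lebesgue. V s * of_real (\<phi> s))
      + u0\<^sup>2 * (LINT s|lebesgue. cnj (V s) * of_real (\<phi> s))" .
  have "(LINT s|lebesgue. - \<i> * mode k s * of_real (\<phi> s)) = - \<i> * (LINT s|lebesgue. mode k s * of_real (\<phi> s))"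
    unfolding mult.assoc by (rule integral_mult_right_zero)
  then show "(LINT s|lebesgue. V s * dual_op d \<omega> (of_real \<zeta> - \<i> - 2 * of_real ((cmod u0)\<^sup>2)) \<phi> s)
      - u0\<^sup>2 * (LINT s|lebesgue. cnj (V s) * of_real (\<phi> s)) = (LINT s|lebesgue. - \<i> * mode k s * of_real (\<phi> s))"
    using weak[OF \<phi>] unfolding split integrable_dual_op(2)[OF Vi \<phi>]
    by (simp only:) algebra
qed

lemma set_integral_as_weighted:
  fixes g :: "real \<Rightarrow> complex"
  shows "(LINT s:S|lebesgue. g s) = (LINT s|lebesgue. g s * indicator S s)"
  unfolding set_lebesgue_integral_def
  by (rule Bochner_Integration.integral_cong) (auto simp: indicator_def)

lemma integrable_indicator_Ioo: "integrable lebesgue (indicator {a<..<b::real} :: real \<Rightarrow> complex)"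
proof -
  have "integrable lebesgue (\<lambda>s. indicat_real {a<..<b} s *\<^sub>R (indicator {a..b} s :: complex))"
    by (rule integrable_mult_indicator[OF _ integrable_indicator_complex]) simp
  moreover have "indicat_real {a<..<b} s *\<^sub>R (indicator {a..b} s :: complex) = indicator {a<..<b} s" for s
    by (auto simp: indicator_def)
  ultimately show ?thesis by simp
qed

lemma L2_norm_square:
  "(L2_norm w)\<^sup>2 = Re (LINT s:{0<..<2*pi}|lebesgue. w s * cnj (w s))"
proof -
  have nonneg: "0 \<le> (LINT s:{0<..<2*pi}|lebesgue. (cmod (w s))\<^sup>2)"
    unfolding set_lebesgue_integral_def by (rule integral_nonneg_AE) simp
  have "(LINT s:{0<..<2*pi}|lebesgue. w s * cnj (w s)) =
      (LINT s:{0<..<2*pi}|lebesgue. complex_of_real ((cmod (w s))\<^sup>2))"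
    unfolding complex_norm_square ..
  also have "\<dots> = of_real (LINT s:{0<..<2*pi}|lebesgue. (cmod (w s))\<^sup>2)"
    by (rule set_integral_complex_of_real)
  finally show ?thesis
    using nonneg by (simp add: L2_norm_def)
qed

lemma ess_bounded_set_integrable:
  "ess_bounded w \<Longrightarrow> set_integrable lebesgue {a<..<b} w"
  by (rule set_integrable_subset[of _ "{a..b}"])
    (auto intro: loc_integrable_Icc ess_bounded_imp_loc_integrable)

lemma cnj_set_integral:
  fixes w :: "real \<Rightarrow> complex"
  shows "(LINT s:S|lebesgue. cnj (w s)) = cnj (LINT s:S|lebesgue. w s)"
  unfolding set_lebesgue_integral_def complex_cnj_scaleR[symmetric] by (simp only: Bochner_Integration.integral_cnj)

theorem theorem13:
  fixes d \<zeta> \<omega> f0 :: real and k1 :: nat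
    and u0 \<alpha> \<beta> x y z \<epsilon> :: complex
    and u :: "real \<Rightarrow> real \<Rightarrow> complex"
  assumes "d \<noteq> 0" and "k1 \<ge> 1"
    and "lle_solution d \<zeta> \<omega> f0 k1 0 (\<lambda>_. u0)"
    and "non_degenerate d \<zeta> \<omega> u0"
    and "local_solution_curve d \<zeta> \<omega> f0 k1 u0 u"
    and "\<alpha> = - \<i> * (of_real d * of_nat k1 ^ 2 + of_nat k1 * of_real \<omega> + of_real \<zeta> + \<i>
                    - 2 * of_real ((cmod u0)\<^sup>2)) /
             ((of_real \<zeta> + of_real d * of_nat k1 ^ 2 - 2 * of_real ((cmod u0)\<^sup>2))\<^sup>2
              - (of_real \<omega> * of_nat k1 + \<i>)\<^sup>2 - of_real (cmod u0 ^ 4))"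
    and "\<beta> = \<i> * u0\<^sup>2 /
             ((of_real \<zeta> + of_real d * of_nat k1 ^ 2 - 2 * of_real ((cmod u0)\<^sup>2))\<^sup>2
              - (of_real \<omega> * of_nat k1 - \<i>)\<^sup>2 - of_real (cmod u0 ^ 4))"
    and "x = of_real \<zeta> - \<i> - 2 * of_real ((cmod u0)\<^sup>2)"
    and "y = - (u0\<^sup>2)"
    and "z = 4 * u0 * of_real ((cmod \<alpha>)\<^sup>2 + (cmod \<beta>)\<^sup>2) + 4 * cnj u0 * \<alpha> * \<beta>"
    and "\<epsilon> = (- cnj z * y + z * cnj x) / of_real ((cmod x)\<^sup>2 - (cmod y)\<^sup>2)"
  shows "((\<lambda>f1. (L2_norm (u f1))\<^sup>2) has_real_derivative 0) (at 0) \<and>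
    (\<forall>\<^sub>F f in nhds 0. (\<lambda>f1. (L2_norm (u f1))\<^sup>2) differentiable at f) \<and>
    (deriv (\<lambda>f1. (L2_norm (u f1))\<^sup>2) has_real_derivative
       4 * pi * (Re (u0 * cnj \<epsilon>) + (cmod \<alpha>)\<^sup>2 + (cmod \<beta>)\<^sup>2)) (at 0)"
proof -
  note nd = assms(4) and x = assms(8) and y = assms(9) and z = assms(10)
  define k where "k = int k1"
  have k: "k \<noteq> 0" "2 * k \<noteq> 0" using assms(2) by (auto simp: k_def)
  have k1: "complex_of_nat k1 = of_int k" by (simp add: k_def)
  obtain \<delta> where \<delta>: "\<delta> > 0" and smooth: "smooth_H2_curve_on {-\<delta><..<\<delta>} u"
    and sol: "\<And>f. f \<in> {-\<delta><..<\<delta>} \<Longrightarrow> lle_solution d \<zeta> \<omega> f0 k1 f (u f)"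
    and u0: "AE s in lebesgue. u 0 s = u0"
    using assms(5) unfolding local_solution_curve_def by blast
  let ?J = "{-\<delta><..<\<delta>}" and ?I = "{0<..<2*pi} :: real set"
  have J0: "0 \<in> ?J" using \<delta> by simp
  obtain D :: "nat \<Rightarrow> real \<Rightarrow> real \<Rightarrow> complex" where D0: "\<And>f. f \<in> ?J \<Longrightarrow> D 0 f = u f"
    and D: "\<And>n f. f \<in> ?J \<Longrightarrow> D n f \<in> H2per" "\<And>n f. f \<in> ?J \<Longrightarrow> has_H2_derivative (D n) (D (Suc n) f) f"
    using smooth unfolding smooth_H2_curve_on_def by blast
  have ess: "has_ess_derivative (D n) (D (Suc n) f) f" if f: "f \<in> ?J" for n f
  proof (rule has_H2_derivative_imp_ess)
    have "\<forall>\<^sub>F t in at f. t \<in> ?J"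
      using f by (intro eventually_at_in_open') auto
    then have "\<forall>\<^sub>F h in at 0. f + h \<in> ?J"
      by (subst (asm) eventually_at_to_0) (simp only: add.commute)
    then show "\<forall>\<^sub>F h in at 0. D n (f + h) \<in> H2per"
      by eventually_elim (rule D)
  qed (use f D in auto)
  define U where "U = D 0"
  define V where "V = D 1"
  define W where "W = D 2 0"
  have U: "has_ess_derivative U (V f) f" if "f \<in> ?J" for f
    using ess[OF that, of 0] by (simp add: U_def V_def)
  have V: "has_ess_derivative V W 0"
    using ess[OF J0, of 1] by (simp add: V_def W_def numeral_2_eq_2)
  have U0: "AE s in lebesgue. U 0 s = u0"
    using u0 D0[OF J0] by (simp add: U_def)
  have H2: "V 0 \<in> H2per" "W \<in> H2per" "U 0 \<in> H2per"
    using D(1)[OF J0] by (auto simp: U_def V_def W_def)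
  have bd: "ess_bounded (U 0)" "ess_bounded (V 0)" "ess_bounded W"
    using H2 by (auto intro: H2per_ess_bounded)
  have solU: "lle_solution d \<zeta> \<omega> f0 k1 f (U f)" if "f \<in> ?J" for f
    using sol[OF that] D0[OF that] by (simp add: U_def)
  have "\<forall>f\<in>?J. lle_solution d \<zeta> \<omega> f0 k1 f (U f)" "\<forall>f\<in>?J. has_ess_derivative U (V f) f"
    using solU U by blast+
  note variations = lle_curve_derivatives[OF \<delta> this V U0, folded k_def]

  define P where "P = of_real d * of_int k ^ 2 - of_real \<omega> * of_int k + (of_real \<zeta> - \<i> - 2 * of_real ((cmod u0)\<^sup>2))"
  define Q where "Q = of_real d * of_int k ^ 2 + of_real \<omega> * of_int k + (of_real \<zeta> - \<i> - 2 * of_real ((cmod u0)\<^sup>2))"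
  \<comment> \<open>In terms of \<open>t\<close> and \<open>w\<close>, the determinant of the amplitude system and its conjugate are the denominators of \<open>\<alpha>\<close> and \<open>\<beta>\<close>.\<close>
  define t where "t = complex_of_real \<zeta> + of_real d * of_nat k1 ^ 2 - 2 * of_real ((cmod u0)\<^sup>2)"
  define w where "w = complex_of_real \<omega> * of_nat k1"
  have PQ: "P = t - w - \<i>" "Q = t + w - \<i>" "cnj P = t - w + \<i>" "cnj Q = t + w + \<i>"
    by (simp_all add: P_def Q_def t_def w_def k1)
  have den: "P * cnj Q - of_real (cmod u0 ^ 4) = t\<^sup>2 - (w + \<i>)\<^sup>2 - of_real (cmod u0 ^ 4)"
    unfolding PQ(1,4) by (simp only: power2_eq_square) algebra
  have den': "cnj (P * cnj Q - of_real (cmod u0 ^ 4)) = t\<^sup>2 - (w - \<i>)\<^sup>2 - of_real (cmod u0 ^ 4)"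
    unfolding complex_cnj_diff complex_cnj_mult complex_cnj_cnj complex_cnj_complex_of_real PQ(2,3)
    by (simp only: power2_eq_square) algebra
  have \<alpha>: "\<alpha> = - \<i> * cnj Q / (P * cnj Q - of_real (cmod u0 ^ 4))"
    unfolding den assms(6) unfolding PQ(4) t_def w_def by (simp add: algebra_simps)
  have \<beta>: "\<beta> = \<i> * u0\<^sup>2 / cnj (P * cnj Q - of_real (cmod u0 ^ 4))"
    unfolding den' assms(7) t_def w_def ..
  note amp = first_order_amplitudes[OF non_degenerate_determinant[OF nd k(1) P_def Q_def] \<alpha> \<beta>]

  have V0: "AE s in lebesgue. V 0 s = \<alpha> * mode k s + \<beta> * mode (- k) s"
  proof -
    have "AE s in lebesgue. lin_op d \<zeta> \<omega> u0 (V 0) s = - \<i> * mode k s"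
      by (rule first_variation_lin_op[OF H2(1) variations(1)])
    then have "AE s in lebesgue. lin_op d \<zeta> \<omega> u0 (V 0) s =
        lin_op d \<zeta> \<omega> u0 (\<lambda>s. \<alpha> * mode k s + \<beta> * mode (- k) s) s"
      using lin_op_two_modes[of d \<zeta> \<omega> u0 \<alpha> k \<beta>]
      unfolding P_def[symmetric] Q_def[symmetric] amp
      by eventually_elim simp
    then show ?thesis
      using nd H2(1) H2per_lincomb[OF mode_H2per mode_H2per] unfolding non_degenerate_def by blast
  qed
  define S where "S = complex_of_real ((cmod \<alpha>)\<^sup>2 + (cmod \<beta>)\<^sup>2)"
  have meas: "g \<in> borel_measurable lebesgue" if "ess_bounded g" for g
    using that by (rule ess_bounded_measurable)
  have intV: "(LINT s:?I|lebesgue. V 0 s) = 0"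
  proof -
    have "(LINT s:?I|lebesgue. V 0 s) = (LINT s:?I|lebesgue. 0 + \<alpha> * mode k s + \<beta> * mode (- k) s)"
      by (rule set_integral_cong_AE_UNIV)
        (use V0 in \<open>auto intro!: meas bd ess_bounded_add ess_bounded_mult ess_bounded_const ess_bounded_mode\<close>)
    then show ?thesis by (simp only: set_integral_two_modes[OF k(1)] mult_zero_right)
  qed
  have intVV: "(LINT s:?I|lebesgue. V 0 s * cnj (V 0 s)) = 2 * pi * S"
  proof -
    have "AE s in lebesgue. V 0 s * cnj (V 0 s) =
        S + \<alpha> * cnj \<beta> * mode (2 * k) s + \<beta> * cnj \<alpha> * mode (- (2 * k)) s"
      using V0 unfolding S_def two_modes_norm_square[symmetric] by eventually_elim simp
    then have "(LINT s:?I|lebesgue. V 0 s * cnj (V 0 s)) =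
        (LINT s:?I|lebesgue. S + \<alpha> * cnj \<beta> * mode (2 * k) s + \<beta> * cnj \<alpha> * mode (- (2 * k)) s)"
      by (rule set_integral_cong_AE_UNIV)
        (intro meas bd ess_bounded_add ess_bounded_mult ess_bounded_const ess_bounded_mode ess_bounded_cnj)+
    then show ?thesis by (simp only: set_integral_two_modes[OF k(2)])
  qed
  have intV2: "(LINT s:?I|lebesgue. V 0 s * V 0 s) = 2 * pi * (2 * \<alpha> * \<beta>)"
  proof -
    have "AE s in lebesgue. V 0 s * V 0 s =
        2 * \<alpha> * \<beta> + \<alpha>\<^sup>2 * mode (2 * k) s + \<beta>\<^sup>2 * mode (- (2 * k)) s"
      using V0 unfolding two_modes_square[symmetric] by eventually_elim simp
    then have "(LINT s:?I|lebesgue. V 0 s * V 0 s) =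
        (LINT s:?I|lebesgue. 2 * \<alpha> * \<beta> + \<alpha>\<^sup>2 * mode (2 * k) s + \<beta>\<^sup>2 * mode (- (2 * k)) s)"
      by (rule set_integral_cong_AE_UNIV)
        (intro meas bd ess_bounded_add ess_bounded_mult ess_bounded_const ess_bounded_mode)+
    then show ?thesis by (simp only: set_integral_two_modes[OF k(2)])
  qed

  define m where "m = (LINT s:?I|lebesgue. W s) / (2 * pi)"
  have intW: "(LINT s:?I|lebesgue. W s) = 2 * pi * m"
    by (simp add: m_def)
  have "m = \<epsilon>"
    unfolding assms(11)
  proof (rule solve_conjugate_linear[OF non_degenerate_mean[OF nd x y]])
    let ?R = "\<lambda>s. 2 * of_real ((cmod u0)\<^sup>2) * W s + u0\<^sup>2 * cnj (W s)
          + 4 * u0 * (V 0 s * cnj (V 0 s)) + 2 * cnj u0 * (V 0 s * V 0 s)"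
    obtain \<phi> where \<phi>: "test_function \<phi>"
      and \<phi>0: "\<And>w. loc_integrable w \<Longrightarrow> (AE s in lebesgue. w (s + 2 * pi) = w s) \<Longrightarrow>
        (LINT s|lebesgue. w s * of_real (\<phi> s)) = (LINT s:{0<..<2*pi}|lebesgue. w s)"
      and \<phi>1: "\<And>w. loc_integrable w \<Longrightarrow> (AE s in lebesgue. w (s + 2 * pi) = w s) \<Longrightarrow>
        (LINT s|lebesgue. w s * of_real (deriv \<phi> s)) = 0"
      and \<phi>2: "\<And>w. loc_integrable w \<Longrightarrow> (AE s in lebesgue. w (s + 2 * pi) = w s) \<Longrightarrow>
        (LINT s|lebesgue. w s * of_real (deriv (deriv \<phi>) s)) = 0"
      by (rule periodic_partition_of_unity) (rule that; assumption)
    have per: "AE s in lebesgue. W (s + 2 * pi) = W s" "AE s in lebesgue. V 0 (s + 2 * pi) = V 0 s"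
      using H2 by (auto simp: H2per_def)
    then have perR: "AE s in lebesgue. ?R (s + 2 * pi) = ?R s"
      by eventually_elim simp
    have R: "ess_bounded ?R"
      by (intro ess_bounded_add ess_bounded_mult ess_bounded_const ess_bounded_cnj bd)
    have Wi: "loc_integrable W" by (rule H2per_loc_integrable[OF H2(2)])
    \<comment> \<open>Only the zeroth order part of the transposed operator survives the pairing with \<open>\<phi>\<close>.\<close>
    have lhs: "(LINT s|lebesgue. W s * dual_op d \<omega> (of_real \<zeta> - \<i>) \<phi> s) = (of_real \<zeta> - \<i>) * (2 * pi * m)"
      using \<phi>0[OF Wi per(1)] \<phi>1[OF Wi per(1)] \<phi>2[OF Wi per(1)]
      by (simp add: integrable_dual_op(2)[OF Wi \<phi>] intW)
    have "(LINT s|lebesgue. ?R s * of_real (\<phi> s)) = (LINT s:?I|lebesgue. ?R s)"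
      by (rule \<phi>0[OF ess_bounded_imp_loc_integrable[OF R] perR])
    also have "\<dots> = (LINT s:?I|lebesgue. 2 * of_real ((cmod u0)\<^sup>2) * W s) + (LINT s:?I|lebesgue. u0\<^sup>2 * cnj (W s))
        + (LINT s:?I|lebesgue. 4 * u0 * (V 0 s * cnj (V 0 s))) + (LINT s:?I|lebesgue. 2 * cnj u0 * (V 0 s * V 0 s))"
      by (subst set_integral_add, (intro set_integral_add ess_bounded_set_integrable ess_bounded_add ess_bounded_mult ess_bounded_const ess_bounded_cnj bd)+)+ simp
    also have "\<dots> = 2 * of_real ((cmod u0)\<^sup>2) * (2 * pi * m) + u0\<^sup>2 * cnj (2 * pi * m)
        + 4 * u0 * (2 * pi * S) + 2 * cnj u0 * (2 * pi * (2 * \<alpha> * \<beta>))"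
      by (simp only: set_integral_mult_right cnj_set_integral intW intVV intV2)
    finally have "(of_real \<zeta> - \<i>) * (2 * pi * m) = 2 * of_real ((cmod u0)\<^sup>2) * (2 * pi * m) + u0\<^sup>2 * cnj (2 * pi * m)
        + 4 * u0 * (2 * pi * S) + 2 * cnj u0 * (2 * pi * (2 * \<alpha> * \<beta>))"
      using variations(2)[OF \<phi>] unfolding lhs by simp
    then have "2 * complex_of_real pi * (x * m + y * cnj m) = 2 * complex_of_real pi * z"
      unfolding x y z S_def by (simp add: algebra_simps)
    then show "x * m + y * cnj m = z"
      by simp
  qed

  \<comment> \<open>The squared norm is an integral of a product, so the product rule for curves gives its derivatives.\<close>
  define N where "N f = Re (LINT s|lebesgue. (U f s * cnj (U f s)) * indicator ?I s)" for f
  define N1 where "N1 f = Re (LINT s|lebesgue. (V f s * cnj (U f s) + U f s * cnj (V f s)) * indicator ?I s)" for f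
  define N2 where "N2 = Re (LINT s|lebesgue. ((W s * cnj (U 0 s) + V 0 s * cnj (V 0 s))
    + (V 0 s * cnj (V 0 s) + U 0 s * cnj (W s))) * indicator ?I s)"
  note ind = integrable_indicator_Ioo[of 0 "2 * pi"]
  have N: "(N has_real_derivative N1 f) (at f)" if "f \<in> ?J" for f
    unfolding N_def[abs_def] N1_def has_real_derivative_iff_has_vector_derivative
    by (rule bounded_linear.has_vector_derivative[OF bounded_linear_Re has_ess_derivative_integral[OF
          has_ess_derivative_mult[OF U[OF that] has_ess_derivative_cnj[OF U[OF that]]] ind]])
  have N1: "(N1 has_real_derivative N2) (at 0)"
    unfolding N1_def[abs_def] N2_def has_real_derivative_iff_has_vector_derivative
    by (rule bounded_linear.has_vector_derivative[OF bounded_linear_Re has_ess_derivative_integral[OF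
          has_ess_derivative_add[OF has_ess_derivative_mult[OF V has_ess_derivative_cnj[OF U[OF J0]]]
            has_ess_derivative_mult[OF U[OF J0] has_ess_derivative_cnj[OF V]]] ind]])
  have "N1 0 = 0"
  proof -
    have "(LINT s:?I|lebesgue. V 0 s * cnj (U 0 s) + U 0 s * cnj (V 0 s)) =
        (LINT s:?I|lebesgue. cnj u0 * V 0 s + u0 * cnj (V 0 s))"
      by (rule set_integral_cong_AE_UNIV)
        (use U0 in \<open>auto intro!: meas ess_bounded_add ess_bounded_mult ess_bounded_const ess_bounded_cnj bd
          elim!: eventually_mono\<close>)
    also have "\<dots> = (LINT s:?I|lebesgue. cnj u0 * V 0 s) + (LINT s:?I|lebesgue. u0 * cnj (V 0 s))"
      by (intro set_integral_add ess_bounded_set_integrable ess_bounded_mult ess_bounded_const ess_bounded_cnj bd)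
    also have "\<dots> = 0"
      by (simp add: cnj_set_integral intV)
    finally show ?thesis
      by (simp add: N1_def set_integral_as_weighted[symmetric])
  qed
  have N2: "N2 = 4 * pi * (Re (u0 * cnj \<epsilon>) + (cmod \<alpha>)\<^sup>2 + (cmod \<beta>)\<^sup>2)"
  proof -
    have "(LINT s:?I|lebesgue. ((W s * cnj (U 0 s) + V 0 s * cnj (V 0 s)) + (V 0 s * cnj (V 0 s) + U 0 s * cnj (W s)))) =
        (LINT s:?I|lebesgue. cnj u0 * W s + u0 * cnj (W s) + 2 * (V 0 s * cnj (V 0 s)))"
      by (rule set_integral_cong_AE_UNIV)
        (use U0 in \<open>auto intro!: meas ess_bounded_add ess_bounded_mult ess_bounded_const ess_bounded_cnj bd
          elim!: eventually_mono\<close>)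
    also have "\<dots> = (LINT s:?I|lebesgue. cnj u0 * W s) + (LINT s:?I|lebesgue. u0 * cnj (W s))
        + (LINT s:?I|lebesgue. 2 * (V 0 s * cnj (V 0 s)))"
      by (subst set_integral_add, (intro set_integral_add ess_bounded_set_integrable ess_bounded_add ess_bounded_mult ess_bounded_const ess_bounded_cnj bd)+)+ simp
    also have "\<dots> = cnj u0 * (2 * pi * m) + u0 * cnj (2 * pi * m) + 2 * (2 * pi * S)"
      by (simp only: set_integral_mult_right cnj_set_integral intW intVV)
    finally have "N2 = Re (cnj u0 * (2 * pi * \<epsilon>) + u0 * cnj (2 * pi * \<epsilon>) + 2 * (2 * pi * S))"
      unfolding N2_def set_integral_as_weighted[symmetric] \<open>m = \<epsilon>\<close> by (rule arg_cong)
    then show ?thesis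
      by (simp add: S_def algebra_simps)
  qed
  let ?n = "\<lambda>f1. (L2_norm (u f1))\<^sup>2"
  have nN: "?n f = N f" if "f \<in> ?J" for f
    using D0[OF that] by (simp add: L2_norm_square N_def U_def set_integral_as_weighted)
  have n: "(?n has_real_derivative N1 f) (at f)" if "f \<in> ?J" for f
    by (rule has_field_derivative_transform_within_open[OF N[OF that], of ?J]) (use that nN in auto)
  have "deriv ?n f = N1 f" if "f \<in> ?J" for f
    using n[OF that] by (rule DERIV_imp_deriv)
  then have "(deriv ?n has_real_derivative N2) (at 0)"
    by (intro has_field_derivative_transform_within_open[OF N1, of ?J]) (use J0 in auto)
  moreover have "\<forall>\<^sub>F f in nhds 0. ?n differentiable at f"
  proof -
    have "\<forall>\<^sub>F f in nhds 0. f \<in> ?J"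
      using J0 by (intro eventually_nhds_in_open) auto
    then show ?thesis
      by eventually_elim (use n real_differentiable_def in blast)
  qed
  ultimately show ?thesis
    using n[OF J0] \<open>N1 0 = 0\<close> N2 by simp
qed

end
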